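(* Let $m \leq n$ and let $f_1, \ldots, f_m \in \mathbb{Q}(x_1,\ldots,x_n)$ be nonzero. Then the rational function \[ \det \left(\frac{\theta_i f_j}{f_j} \right)_{i, j = 1, \ldots, m} \;=\; \frac{x_1 \cdots x_m}{f_1 \cdots f_m} \det \left(\frac{\partial f_j}{\partial x_i} \right)_{i, j = 1, \ldots, m}, \] where $\theta_i = x_i \frac{\partial}{\partial x_i}$, has the Gauss property.
   Context: Write $\boldsymbol{x}=(x_1,\dots,x_n)$ and $\boldsymbol{x}^{\boldsymbol{k}}=x_1^{k_1}\cdots x_n^{k_n}$. For a Laurent polynomial $Q=\sum_{\boldsymbol{k}} q_{\boldsymbol{k}}\boldsymbol{x}^{\boldsymbol{k}}\in\mathbb{Z}[x_1^{\pm1},\dots,x_n^{\pm1}]$, its support is the set of $\boldsymbol{k}$ with $q_{\boldsymbol{k}}\neq 0$, and its Newton polytope $N(Q)$ is the convex hull of its support. For a vertex $\boldsymbol{v}$ of $N(Q)$, one expands $\boldsymbol{x}^{\boldsymbol{v}}/Q = \frac{1}{q_{\boldsymbol{v}}}\sum_{m\ge0}\big(-\sum_{\boldsymbol{k}\neq\boldsymbol{v}}\frac{q_{\boldsymbol{k}}}{q_{\boldsymbol{v}}}\boldsymbol{x}^{\boldsymbol{k}-\boldsymbol{v}}\big)^m$ as a formal Laurent series (well defined, supported in the cone generated by $N(Q/\boldsymbol{x}^{\boldsymbol{v}})$, which is proper, i.e. some linear form is positive on all its nonzero elements); multiplying by $P/\boldsymbol{x}^{\boldsymbol{v}}$ gives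 the Laurent series expansion of $F=P/Q$ ($P,Q\in\mathbb{Z}[\boldsymbol{x}^{\pm1}]$) with respect to $\boldsymbol{v}$. A formal Laurent series $f=\sum_{\boldsymbol{k}\in\mathbb{Z}^n} f_{\boldsymbol{k}}\boldsymbol{x}^{\boldsymbol{k}}$ with rational coefficients satisfies the Gauss congruences for the prime $p$ if all $f_{\boldsymbol{k}}\in\mathbb{Z}_p$ and $f_{\boldsymbol{m}p^r}\equiv f_{\boldsymbol{m}p^{r-1}} \pmod{p^r}$ for all $\boldsymbol{m}\in\mathbb{Z}^n$ and all $r\ge1$; it has the Gauss property if it satisfies the Gauss congruences for all but finitely many primes. A rational function $F\in\mathbb{Q}(\boldsymbol{x})$, written $F=P/Q$ with $P,Q\in\mathbb{Z}[\boldsymbol{x}^{\pm1}]$, has the Gauss property if for every vertex $\boldsymbol{v}$ of $N(Q)$ the Laurent series expansion of $F$ with respect to $\boldsymbol{v}$ has the Gauss property. *)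

theory Defs
  imports
    "HOL-Analysis.Analysis"
    "HOL-Library.Poly_Mapping"
    "HOL-Library.Groups_Big_Fun"
    "HOL-Computational_Algebra.Fraction_Field"
    "HOL-Computational_Algebra.Primes"
    "Jordan_Normal_Form.Determinant"
begin

section \<open>Laurent polynomials and rational functions\<close>

text \<open>
  The number of variables is \<open>n = CARD('n)\<close>. As \<open>'n\<close> is finite, \<open>'n \<Rightarrow>\<^sub>0 int\<close> is
  the full exponent lattice \<open>\<int>\<^sup>n\<close>, and \<open>('n, 'c) laurent\<close> with the convolution product
  is the Laurent polynomial ring over \<open>'c\<close>. A linear order on the set of variables is
  needed for the library to know that this ring is a domain; it also fixes the numbering
  of the variables, see \<open>var\<close> below. The field of fractions of the ring of integral
  Laurent polynomials is the field of rational functions over the rationals.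
\<close>

type_synonym ('n, 'c) laurent = "('n \<Rightarrow>\<^sub>0 int) \<Rightarrow>\<^sub>0 'c"

type_synonym 'n ratfun = "('n, int) laurent fract"

text \<open>Numbering starts at 0: \<open>var 0 < var 1 < \<dots> < var (n - 1)\<close> are all the variables.\<close>

definition var :: "nat \<Rightarrow> 'n::{finite,linorder}" where
  "var i = sorted_list_of_set UNIV ! i"

definition ratfun_var :: "'n::{finite,linorder} \<Rightarrow> 'n ratfun" where
  "ratfun_var i = Fract (Poly_Mapping.single (Poly_Mapping.single i 1) 1) 1"

definition laurent_pderiv :: "'n \<Rightarrow> ('n, int) laurent \<Rightarrow> ('n, int) laurent" where
  "laurent_pderiv i P = (\<Sum>k\<in>Poly_Mapping.keys P.
     Poly_Mapping.single (k - Poly_Mapping.single i 1)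
       (Poly_Mapping.lookup k i * Poly_Mapping.lookup P k))"

lemma lookup_laurent_pderiv:
  "Poly_Mapping.lookup (laurent_pderiv i P) k =
     (Poly_Mapping.lookup k i + 1) * Poly_Mapping.lookup P (k + Poly_Mapping.single i 1)"
proof -
  have "Poly_Mapping.lookup (laurent_pderiv i P) k =
      (\<Sum>l\<in>Poly_Mapping.keys P. if l = k + Poly_Mapping.single i 1
         then Poly_Mapping.lookup l i * Poly_Mapping.lookup P l else 0)"
    unfolding laurent_pderiv_def lookup_sum
    by (intro sum.cong refl) (auto simp: lookup_single when_def)
  also have "\<dots> = (Poly_Mapping.lookup k i + 1) *
      Poly_Mapping.lookup P (k + Poly_Mapping.single i 1)"
    by (auto simp: sum.delta lookup_add in_keys_iff)
  finally show ?thesis .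
qed

lemma laurent_pderiv_add:
  "laurent_pderiv i (P + Q) = laurent_pderiv i P + laurent_pderiv i Q"
  by (rule poly_mapping_eqI) (simp add: lookup_laurent_pderiv lookup_add algebra_simps)

lemma laurent_pderiv_0: "laurent_pderiv i 0 = 0"
  by (simp add: laurent_pderiv_def)

lemma laurent_pderiv_sum:
  "laurent_pderiv i (sum g A) = (\<Sum>a\<in>A. laurent_pderiv i (g a))"
  by (induction A rule: infinite_finite_induct) (auto simp: laurent_pderiv_add laurent_pderiv_0)

lemma laurent_pderiv_single:
  "laurent_pderiv i (Poly_Mapping.single k c) =
     Poly_Mapping.single (k - Poly_Mapping.single i 1) (Poly_Mapping.lookup k i * c)"
  by (cases "c = 0") (auto simp: laurent_pderiv_def)

lemma laurent_sum_singles: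
  "P = (\<Sum>k\<in>Poly_Mapping.keys P. Poly_Mapping.single k (Poly_Mapping.lookup P k))"
  by (rule poly_mapping_eqI)
     (auto simp: lookup_sum lookup_single when_def sum.delta' in_keys_iff)

lemma laurent_pderiv_mult:
  "laurent_pderiv i (P * Q) = laurent_pderiv i P * Q + P * laurent_pderiv i Q"
proof -
  have single: "laurent_pderiv i (Poly_Mapping.single k a * Poly_Mapping.single l b) =
      laurent_pderiv i (Poly_Mapping.single k a) * Poly_Mapping.single l b +
      Poly_Mapping.single k a * laurent_pderiv i (Poly_Mapping.single l b)" for k l a b
    by (simp add: laurent_pderiv_single mult_single lookup_add algebra_simps single_add)
  let ?A = "Poly_Mapping.keys P" and ?B = "Poly_Mapping.keys Q"
  let ?p = "\<lambda>k. Poly_Mapping.single k (Poly_Mapping.lookup P k)"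
  let ?q = "\<lambda>k. Poly_Mapping.single k (Poly_Mapping.lookup Q k)"
  have "laurent_pderiv i (sum ?p ?A * sum ?q ?B) =
      laurent_pderiv i (sum ?p ?A) * sum ?q ?B + sum ?p ?A * laurent_pderiv i (sum ?q ?B)"
    by (simp only: laurent_pderiv_sum sum_product single sum.distrib)
  then show ?thesis
    by (simp only: laurent_sum_singles[symmetric])
qed

lemma pderiv_quotient_cong:
  fixes P Q P' Q' :: "('n::{finite,linorder}, int) laurent"
  assumes nz: "Q \<noteq> 0" "Q' \<noteq> 0" and eq: "Fract P Q = Fract P' Q'"
  shows "Fract (laurent_pderiv i P * Q - P * laurent_pderiv i Q) (Q * Q) =
         Fract (laurent_pderiv i P' * Q' - P' * laurent_pderiv i Q') (Q' * Q')"
proof -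
  let ?D = "laurent_pderiv i"
  have eq': "P * Q' = P' * Q"
    using nz eq by (simp add: eq_fract)
  have "?D P * Q' + P * ?D Q' = ?D P' * Q + P' * ?D Q"
    using arg_cong[OF eq', of ?D] by (simp add: laurent_pderiv_mult)
  then have D: "?D P * Q' = ?D P' * Q + P' * ?D Q - P * ?D Q'"
    by (simp add: algebra_simps)
  have "(?D P * Q - P * ?D Q) * (Q' * Q') = Q * Q' * (?D P * Q') - (P * Q') * Q' * ?D Q"
    by (simp add: algebra_simps)
  also have "\<dots> = ?D P' * Q * Q * Q' + P' * Q * Q' * ?D Q - P * Q' * Q * ?D Q' - P * Q' * Q' * ?D Q"
    unfolding D by (simp add: algebra_simps)
  also have "\<dots> = (?D P' * Q' - P' * ?D Q') * (Q * Q)"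
    unfolding eq' by (simp add: algebra_simps)
  finally have "(?D P * Q - P * ?D Q) * (Q' * Q') = (?D P' * Q' - P' * ?D Q') * (Q * Q)" .
  then show ?thesis
    using nz by (simp add: eq_fract)
qed

definition ratfun_pderiv :: "'n::{finite,linorder} \<Rightarrow> 'n ratfun \<Rightarrow> 'n ratfun" where
  "ratfun_pderiv i F = (THE D. \<exists>P Q. Q \<noteq> 0 \<and> F = Fract P Q \<and>
     D = Fract (laurent_pderiv i P * Q - P * laurent_pderiv i Q) (Q * Q))"

lemma ratfun_pderiv_Fract:
  fixes P Q :: "('n::{finite,linorder}, int) laurent"
  assumes "Q \<noteq> 0"
  shows "ratfun_pderiv i (Fract P Q) =
     Fract (laurent_pderiv i P * Q - P * laurent_pderiv i Q) (Q * Q)"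
  unfolding ratfun_pderiv_def
proof (rule the_equality)
  fix D
  assume "\<exists>P' Q'. Q' \<noteq> 0 \<and> Fract P Q = Fract P' Q' \<and>
    D = Fract (laurent_pderiv i P' * Q' - P' * laurent_pderiv i Q') (Q' * Q')"
  then show "D = Fract (laurent_pderiv i P * Q - P * laurent_pderiv i Q) (Q * Q)"
    using pderiv_quotient_cong assms by metis
qed (use assms in blast)

definition theta :: "'n::{finite,linorder} \<Rightarrow> 'n ratfun \<Rightarrow> 'n ratfun" where
  "theta i F = ratfun_var i * ratfun_pderiv i F"


section \<open>Newton polytopes and Laurent series expansions\<close>

definition exponent_vec :: "('n::finite \<Rightarrow>\<^sub>0 int) \<Rightarrow> real ^ 'n" where
  "exponent_vec k = (\<chi> i. real_of_int (Poly_Mapping.lookup k i))"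

definition newton_polytope :: "('n::finite, int) laurent \<Rightarrow> (real ^ 'n) set" where
  "newton_polytope Q = convex hull (exponent_vec ` Poly_Mapping.keys Q)"

text \<open>All vertices of the Newton polytope are lattice points lying in the support, so it is
  enough to consider \<open>v\<close> in the exponent lattice.\<close>

definition newton_vertex :: "('n::finite, int) laurent \<Rightarrow> ('n \<Rightarrow>\<^sub>0 int) \<Rightarrow> bool" where
  "newton_vertex Q v \<longleftrightarrow> exponent_vec v extreme_point_of newton_polytope Q"

text \<open>\<open>Q = q\<^sub>v x\<^sup>v (1 - R)\<close> with \<open>R = geometric_ratio Q v\<close>.\<close>

definition geometric_ratio ::
    "('n, int) laurent \<Rightarrow> ('n \<Rightarrow>\<^sub>0 int) \<Rightarrow> ('n, rat) laurent" where
  "geometric_ratio Q v = - (\<Sum>k\<in>Poly_Mapping.keys Q - {v}.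
     Poly_Mapping.single (k - v)
       (of_int (Poly_Mapping.lookup Q k) / of_int (Poly_Mapping.lookup Q v)))"

text \<open>
  A formal Laurent series is given by its coefficient function. The following is the series
  \<open>x\<^sup>v / Q = 1 / q\<^sub>v \<cdot> (\<Sum>j\<ge>0. R^j)\<close>. For a vertex \<open>v\<close>, each exponent occurs in only finitely
  many of the powers \<open>R^j\<close> (lemma \<open>finite_geometric_ratio\<close> below), so the \<open>Sum_any\<close> is
  a genuine finite sum.
\<close>

definition inverse_expansion ::
    "('n, int) laurent \<Rightarrow> ('n \<Rightarrow>\<^sub>0 int) \<Rightarrow> ('n \<Rightarrow>\<^sub>0 int) \<Rightarrow> rat" where
  "inverse_expansion Q v k =
     1 / of_int (Poly_Mapping.lookup Q v) *
     Sum_any (\<lambda>j::nat. Poly_Mapping.lookup (geometric_ratio Q v ^ j) k)"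

text \<open>The product of \<open>P / x\<^sup>v\<close> with the series \<open>x\<^sup>v / Q\<close>.\<close>

definition laurent_expansion ::
    "('n, int) laurent \<Rightarrow> ('n, int) laurent \<Rightarrow> ('n \<Rightarrow>\<^sub>0 int) \<Rightarrow> ('n \<Rightarrow>\<^sub>0 int) \<Rightarrow> rat" where
  "laurent_expansion P Q v k =
     (\<Sum>l\<in>Poly_Mapping.keys P.
        of_int (Poly_Mapping.lookup P l) * inverse_expansion Q v (k - (l - v)))"

lemma exponent_vec_simps [simp]:
  "exponent_vec 0 = 0"
  "exponent_vec (k + l) = exponent_vec k + exponent_vec l"
  "exponent_vec (k - l) = exponent_vec k - exponent_vec l"
  by (simp_all add: exponent_vec_def Finite_Cartesian_Product.vec_eq_iff lookup_add lookup_minus)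

lemma exponent_vec_inj [simp]: "exponent_vec k = exponent_vec l \<longleftrightarrow> k = l"
  by (auto simp: exponent_vec_def Finite_Cartesian_Product.vec_eq_iff intro: poly_mapping_eqI)

lemma newton_vertex_in_keys:
  assumes "newton_vertex Q v"
  shows "v \<in> Poly_Mapping.keys Q"
proof -
  have "exponent_vec v \<in> exponent_vec ` Poly_Mapping.keys Q"
    using assms extreme_point_of_convex_hull unfolding newton_vertex_def newton_polytope_def
    by blast
  then show ?thesis
    by auto
qed

lemma newton_vertex_linear_form:
  assumes "newton_vertex Q v"
  obtains a :: "real ^ 'n" and e where "e > 0"
    "\<And>k. k \<in> Poly_Mapping.keys Q - {v} \<Longrightarrow> a \<bullet> exponent_vec (k - v) \<ge> e"
proof -
  let ?S = "exponent_vec ` (Poly_Mapping.keys Q - {v})"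
  have ext: "exponent_vec v extreme_point_of newton_polytope Q"
    using assms by (simp add: newton_vertex_def)
  have conv: "convex (newton_polytope Q - {exponent_vec v})"
    using ext extreme_point_of_stillconvex[of "newton_polytope Q" "exponent_vec v"]
    by (auto simp: newton_polytope_def)
  have "?S \<subseteq> newton_polytope Q - {exponent_vec v}"
    by (auto simp: newton_polytope_def intro: hull_inc)
  then have "convex hull ?S \<subseteq> newton_polytope Q - {exponent_vec v}"
    using conv by (rule hull_minimal)
  then have "exponent_vec v \<notin> convex hull ?S"
    by blast
  moreover have "closed (convex hull ?S)"
    by (intro compact_imp_closed finite_imp_compact_convex_hull) auto
  ultimately obtain a b where ab: "a \<bullet> exponent_vec v < b" "\<And>x. x \<in> convex hull ?S \<Longrightarrow> b < a \<bullet> x"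
    using separating_hyperplane_closed_point[of "convex hull ?S" "exponent_vec v"] by auto
  show ?thesis
  proof (rule that[of "b - a \<bullet> exponent_vec v" a])
    fix k assume "k \<in> Poly_Mapping.keys Q - {v}"
    then have "b < a \<bullet> exponent_vec k"
      by (intro ab hull_inc) auto
    then show "b - a \<bullet> exponent_vec v \<le> a \<bullet> exponent_vec (k - v)"
      by (simp add: inner_diff_right)
  qed (use ab in auto)
qed

lemma finite_geometric_ratio:
  assumes "newton_vertex Q v"
  shows "finite {j. Poly_Mapping.lookup (geometric_ratio Q v ^ j) k \<noteq> 0}"
proof -
  obtain a :: "real ^ 'a" and e where e: "e > 0"
    and a: "\<And>k. k \<in> Poly_Mapping.keys Q - {v} \<Longrightarrow> a \<bullet> exponent_vec (k - v) \<ge> e"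
    using newton_vertex_linear_form[OF assms] by metis
  let ?R = "geometric_ratio Q v"
  have R: "a \<bullet> exponent_vec l \<ge> e" if "l \<in> Poly_Mapping.keys ?R" for l
  proof -
    have "l \<in> (\<Union>k\<in>Poly_Mapping.keys Q - {v}. {k - v})"
      using that keys_sum[of _ "Poly_Mapping.keys Q - {v}"]
      unfolding geometric_ratio_def keys_minus
      by (fastforce split: if_splits)
    then show ?thesis
      using a by blast
  qed
  have pow: "a \<bullet> exponent_vec l \<ge> real j * e" if "l \<in> Poly_Mapping.keys (?R ^ j)" for j l
    using that
  proof (induction j arbitrary: l)
    case (Suc j)
    then obtain s t where "l = s + t" "s \<in> Poly_Mapping.keys ?R" "t \<in> Poly_Mapping.keys (?R ^ j)"
      using keys_mult[of ?R "?R ^ j"] by auto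
    then show ?case
      using Suc.IH[of t] R[of s] by (simp add: inner_add_right algebra_simps)
  qed (simp split: if_splits)
  have "j \<le> nat \<lceil>a \<bullet> exponent_vec k / e\<rceil>" if "Poly_Mapping.lookup (?R ^ j) k \<noteq> 0" for j
  proof -
    have "real j \<le> a \<bullet> exponent_vec k / e"
      using pow[of k j] that e by (simp add: in_keys_iff field_simps)
    then show ?thesis
      by linarith
  qed
  then show ?thesis
    by (intro finite_subset[OF _ finite_atMost[of "nat \<lceil>a \<bullet> exponent_vec k / e\<rceil>"]]) auto
qed


section \<open>Gauss congruences\<close>

text \<open>\<open>p_integral p q\<close> says that the rational number \<open>q\<close> is a \<open>p\<close>-adic integer.\<close>

definition p_integral :: "nat \<Rightarrow> rat \<Rightarrow> bool" where
  "p_integral p q \<longleftrightarrow> (\<exists>a b :: int. \<not> int p dvd b \<and> q = of_int a / of_int b)"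

text \<open>Congruence modulo \<open>p\<^sup>r\<close> in the ring of \<open>p\<close>-adic integers, for rational numbers.\<close>

definition p_cong :: "nat \<Rightarrow> nat \<Rightarrow> rat \<Rightarrow> rat \<Rightarrow> bool" where
  "p_cong p r a b \<longleftrightarrow> (\<exists>c. p_integral p c \<and> a - b = of_nat (p ^ r) * c)"

definition gauss_congruences :: "nat \<Rightarrow> (('n \<Rightarrow>\<^sub>0 int) \<Rightarrow> rat) \<Rightarrow> bool" where
  "gauss_congruences p f \<longleftrightarrow>
     (\<forall>k. p_integral p (f k)) \<and>
     (\<forall>m r. r \<ge> 1 \<longrightarrow>
        p_cong p r (f (frag_cmul (int (p ^ r)) m)) (f (frag_cmul (int (p ^ (r - 1))) m)))"

definition series_gauss_property :: "(('n \<Rightarrow>\<^sub>0 int) \<Rightarrow> rat) \<Rightarrow> bool" where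
  "series_gauss_property f \<longleftrightarrow> finite {p. prime p \<and> \<not> gauss_congruences p f}"

text \<open>The property does not depend on how \<open>F\<close> is written as a fraction; all
  representations are required to have it.\<close>

definition gauss_property :: "'n::{finite,linorder} ratfun \<Rightarrow> bool" where
  "gauss_property F \<longleftrightarrow>
     (\<forall>P Q. Q \<noteq> 0 \<and> F = Fract P Q \<longrightarrow>
        (\<forall>v. newton_vertex Q v \<longrightarrow> series_gauss_property (laurent_expansion P Q v)))"

end

theory Submission
  imports Defs
begin

text \<open>
  For a prime \<open>p\<close> let \<open>\<phi>\<close> be the substitution \<open>x \<mapsto> x ^ p\<close>. If \<open>p\<close> divides no leading coefficient
  of the numerator and denominator of \<open>f\<close>, then \<open>f(x ^ p) / f ^ p = 1 + p g\<close> with \<open>g\<close> \<open>p\<close>-integral,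
  and \<open>u = log (1 + p g) / p\<close> is \<open>p\<close>-integral with \<open>\<phi>(\<theta>\<^sub>i f / f) = \<theta>\<^sub>i f / f + \<theta>\<^sub>i u\<close>. So applying \<open>\<phi>\<close> to
  the determinant \<open>d\<close> adds gradients to its columns. As all columns are closed, \<open>\<phi> d - d\<close> is a sum of
  derivatives \<open>\<theta>\<^sub>i h\<close> of \<open>p\<close>-integral functions, whose coefficients at exponents in \<open>p\<^sup>r \<int>\<^sup>n\<close>
  are divisible by \<open>p\<^sup>r\<close>; the coefficients of \<open>\<phi> d - d\<close> there are the differences in the Gauss
  congruences. To stay inside the field of rational functions, the logarithm is truncated
  modulo \<open>p\<^sup>r\<close>. All expansions are taken with respect to one generic real weight
  that selects the given vertex.
\<close>

text \<open>The obstacle is that the series are taken at a vertex of \<open>N(Q)\<close> for an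
  arbitrary denominator \<open>Q\<close> of the determinant, while integrality is visible only on
  numerators and denominators of the \<open>f j\<close>, whose Newton polytopes need not be related
  to that vertex. A weight that vanishes at no nonzero lattice point orders all exponents linearly,
  so it singles out a leading term in every nonzero Laurent polynomial at once. Uniqueness of the
  solution of \<open>Q g = P\<close> then shows that all fractions of the determinant give the same
  series. The primes left out divide a leading coefficient of a numerator or denominator of some
  \<open>f j\<close>. The division by \<open>p\<close> in \<open>u\<close> comes from the chain
  rule: a derivation applied to \<open>f(x ^ p)\<close> gains a factor \<open>p\<close>, so the lift
  of a logarithmic derivative is \<open>1 / p\<close> times the logarithmic derivative of the lift.
  Each \<open>r\<close> is treated separately, so \<open>u\<close> may depend on
  \<open>r\<close>.\<close>

lemma lookup_single_times:
  fixes Q :: "'a::ab_group_add \<Rightarrow>\<^sub>0 'c::comm_ring_1"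
  shows "Poly_Mapping.lookup (Poly_Mapping.single l c * Q) k = c * Poly_Mapping.lookup Q (k - l)"
proof -
  have "Poly_Mapping.lookup (Poly_Mapping.single l c * Q) k =
      Sum_any (\<lambda>l'. (c when l = l') * Sum_any (\<lambda>q. Poly_Mapping.lookup Q q when q = k - l'))"
  proof -
    have "(k = l' + q) = (q = k - l')" for l' q
      by (auto simp: algebra_simps)
    then show ?thesis by (simp add: lookup_mult lookup_single)
  qed
  also have "\<dots> = Sum_any (\<lambda>l'. (c * Poly_Mapping.lookup Q (k - l')) when l = l')"
    by (intro Sum_any.cong) (auto simp: when_def)
  finally show ?thesis by simp
qed

lemma lookup_times:
  fixes P Q :: "'a::ab_group_add \<Rightarrow>\<^sub>0 'c::comm_ring_1"
  shows "Poly_Mapping.lookup (P * Q) k =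
    (\<Sum>l\<in>Poly_Mapping.keys P. Poly_Mapping.lookup P l * Poly_Mapping.lookup Q (k - l))"
  by (subst laurent_sum_singles[of P])
     (simp add: sum_distrib_right lookup_sum lookup_single_times)

section \<open>Laurent polynomials acting on formal series\<close>

text \<open>Two formal series may have no product, since the convolution can be an infinite sum. A
  Laurent polynomial has finite support, so the series form a module over the Laurent polynomials,
  and a fraction is expanded by solving a linear equation in this module.\<close>

definition laurent_act :: "('n, int) laurent \<Rightarrow> (('n \<Rightarrow>\<^sub>0 int) \<Rightarrow> rat) \<Rightarrow> ('n \<Rightarrow>\<^sub>0 int) \<Rightarrow> rat" where
  "laurent_act Q g k =
     (\<Sum>l\<in>Poly_Mapping.keys Q. of_int (Poly_Mapping.lookup Q l) * g (k - l))"

lemma laurent_act_superset: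
  assumes "finite A" "Poly_Mapping.keys Q \<subseteq> A"
  shows "laurent_act Q g k = (\<Sum>l\<in>A. of_int (Poly_Mapping.lookup Q l) * g (k - l))"
  unfolding laurent_act_def using assms
  by (intro sum.mono_neutral_left) (auto simp: in_keys_iff)

lemma laurent_act_0 [simp]: "laurent_act 0 g k = 0"
  by (simp add: laurent_act_def)

lemma laurent_act_add: "laurent_act (P + Q) g k = laurent_act P g k + laurent_act Q g k"
proof -
  let ?A = "Poly_Mapping.keys P \<union> Poly_Mapping.keys Q"
  have "Poly_Mapping.keys (P + Q) \<subseteq> ?A"
    by (rule keys_add)
  then show ?thesis
    by (simp add: laurent_act_superset[of ?A] lookup_add algebra_simps sum.distrib)
qed

lemma laurent_act_sum: "laurent_act (sum F A) g k = (\<Sum>a\<in>A. laurent_act (F a) g k)"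
  by (induction A rule: infinite_finite_induct) (auto simp: laurent_act_add)

lemma laurent_act_single: "laurent_act (Poly_Mapping.single l c) g k = of_int c * g (k - l)"
  by (cases "c = 0") (auto simp: laurent_act_def)

lemma laurent_act_add_right:
  "laurent_act Q (\<lambda>k. g k + h k) k = laurent_act Q g k + laurent_act Q h k"
  by (simp add: laurent_act_def algebra_simps sum.distrib)

lemma laurent_act_minus_right: "laurent_act Q (\<lambda>k. - g k) k = - laurent_act Q g k"
  by (simp add: laurent_act_def sum_negf)

lemma laurent_act_mult: "laurent_act (P * Q) g = laurent_act P (laurent_act Q g)"
proof
  fix k
  let ?A = "Poly_Mapping.keys P" and ?B = "Poly_Mapping.keys Q"
  let ?p = "\<lambda>k. Poly_Mapping.single k (Poly_Mapping.lookup P k)"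
  let ?q = "\<lambda>k. Poly_Mapping.single k (Poly_Mapping.lookup Q k)"
  have "laurent_act (sum ?p ?A * sum ?q ?B) g k = laurent_act P (laurent_act Q g) k"
    unfolding sum_product mult_single laurent_act_sum laurent_act_single
    by (simp add: laurent_act_def sum_distrib_left mult.assoc diff_diff_eq)
  then show "laurent_act (P * Q) g k = laurent_act P (laurent_act Q g) k"
    by (simp only: laurent_sum_singles[symmetric])
qed

lemma laurent_act_poly:
  "laurent_act Q (\<lambda>k. of_int (Poly_Mapping.lookup P k)) k = of_int (Poly_Mapping.lookup (Q * P) k)"
  unfolding laurent_act_def lookup_times by simp

section \<open>Leading exponents\<close>

abbreviation weight :: "real ^ 'n \<Rightarrow> ('n::finite \<Rightarrow>\<^sub>0 int) \<Rightarrow> real" where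
  "weight w k \<equiv> inner w (exponent_vec k)"

text \<open>Expansions run towards larger weight, so the leading term is the one of least weight.
  Strictness says that the linear form \<open>w\<close> attains its minimum on the Newton polytope
  at \<open>v\<close> only.\<close>

definition lead_exponent :: "real ^ 'n \<Rightarrow> ('n::finite, int) laurent \<Rightarrow> ('n \<Rightarrow>\<^sub>0 int) \<Rightarrow> bool" where
  "lead_exponent w Q v \<longleftrightarrow> v \<in> Poly_Mapping.keys Q \<and>
     (\<forall>k\<in>Poly_Mapping.keys Q - {v}. weight w v < weight w k)"

lemma lead_exponent_nonzero: "lead_exponent w Q v \<Longrightarrow> Q \<noteq> 0"
  by (auto simp: lead_exponent_def)

lemma exponent_vec_frag_cmul [simp]: "exponent_vec (frag_cmul c k) = real_of_int c *\<^sub>R exponent_vec k"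
  by (simp add: exponent_vec_def Finite_Cartesian_Product.vec_eq_iff)

text \<open>Any other pair of exponents with sum \<open>u + v\<close> has a component below its
  leading weight. Hence leading coefficients multiply, and a prime that divides neither of them does
  not divide that of the product.\<close>

lemma lead_exponent_mult:
  assumes P: "lead_exponent w P u" and Q: "lead_exponent w Q v"
  shows "lead_exponent w (P * Q) (u + v)"
    and "Poly_Mapping.lookup (P * Q) (u + v) = Poly_Mapping.lookup P u * Poly_Mapping.lookup Q v"
proof -
  have "Poly_Mapping.lookup P l * Poly_Mapping.lookup Q (u + v - l) = 0"
    if "l \<in> Poly_Mapping.keys P - {u}" for l
  proof -
    have "weight w u < weight w l"
      using that P by (auto simp: lead_exponent_def)
    then have "weight w (u + v - l) < weight w v"
      by (simp add: inner_add_right inner_diff_right)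
    then have "u + v - l \<notin> Poly_Mapping.keys Q"
      using Q unfolding lead_exponent_def by (metis DiffI less_asym less_irrefl singletonD)
    then show ?thesis by (simp add: in_keys_iff)
  qed
  then have "(\<Sum>l\<in>Poly_Mapping.keys P. Poly_Mapping.lookup P l * Poly_Mapping.lookup Q (u + v - l)) =
      (\<Sum>l\<in>{u}. Poly_Mapping.lookup P l * Poly_Mapping.lookup Q (u + v - l))"
    using P by (intro sum.mono_neutral_right) (auto simp: lead_exponent_def)
  then show eq: "Poly_Mapping.lookup (P * Q) (u + v) =
      Poly_Mapping.lookup P u * Poly_Mapping.lookup Q v"
    by (simp add: lookup_times)
  have "weight w (u + v) < weight w k"
    if k: "k \<in> Poly_Mapping.keys (P * Q) - {u + v}" for k
  proof -
    obtain s t where st: "k = s + t" "s \<in> Poly_Mapping.keys P" "t \<in> Poly_Mapping.keys Q"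
      using keys_mult[of P Q] k by blast
    then have "s \<noteq> u \<or> t \<noteq> v"
      using k by auto
    moreover have "s = u \<or> weight w u < weight w s"
      "t = v \<or> weight w v < weight w t"
      using st P Q by (auto simp: lead_exponent_def)
    ultimately show ?thesis
      unfolding st by (auto simp: inner_add_right)
  qed
  then show "lead_exponent w (P * Q) (u + v)"
    using eq P Q by (auto simp: lead_exponent_def in_keys_iff)
qed

lemma lead_exponent_exists:
  assumes inj: "\<And>k. weight w k = 0 \<Longrightarrow> k = 0" and "Q \<noteq> 0"
  obtains v where "lead_exponent w Q v"
proof -
  let ?v = "arg_min_on (\<lambda>k. weight w k) (Poly_Mapping.keys Q)"
  have fin: "finite (Poly_Mapping.keys Q)" "Poly_Mapping.keys Q \<noteq> {}"
    using \<open>Q \<noteq> 0\<close> by auto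
  have "weight w ?v < weight w k" if k: "k \<in> Poly_Mapping.keys Q - {?v}" for k
  proof -
    have "\<not> weight w k < weight w ?v"
      using arg_min_if_finite(2)[OF fin, of "\<lambda>k. weight w k"] k by blast
    \<comment> \<open>Equal weights would make the difference of the two exponents a nonzero lattice
      point of weight zero.\<close>
    moreover have "weight w k \<noteq> weight w ?v"
      using inj[of "k - ?v"] k by (auto simp: inner_diff_right)
    ultimately show ?thesis by linarith
  qed
  then show thesis
    using that[of ?v] arg_min_if_finite(1)[OF fin, of "\<lambda>k. weight w k"]
    by (simp add: lead_exponent_def)
qed

lemma countable_exponents: "countable (UNIV :: ('n::finite \<Rightarrow>\<^sub>0 int) set)"
proof (rule countableI')
  have "inj (to_nat \<circ> (\<lambda>k :: 'n \<Rightarrow>\<^sub>0 int. Poly_Mapping.lookup k) :: ('n \<Rightarrow>\<^sub>0 int) \<Rightarrow> nat)"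
    by (intro inj_compose) (auto intro!: injI poly_mapping_eqI simp: fun_eq_iff)
  then show "inj (to_nat \<circ> (\<lambda>k :: 'n \<Rightarrow>\<^sub>0 int. Poly_Mapping.lookup k) :: ('n \<Rightarrow>\<^sub>0 int) \<Rightarrow> nat)" .
qed

text \<open>Countably many hyperplanes do not cover the open cone of weights that select \<open>v\<close>.\<close>

lemma newton_vertex_generic_weight:
  assumes "newton_vertex Q (v :: 'n::finite \<Rightarrow>\<^sub>0 int)"
  obtains w where "\<And>k. weight w k = 0 \<Longrightarrow> k = 0" "lead_exponent w Q v"
proof -
  let ?U = "\<Inter>k\<in>Poly_Mapping.keys Q - {v}. {w. weight w (k - v) > 0}"
  let ?N = "\<Union>k\<in>- {0::'n \<Rightarrow>\<^sub>0 int}. {w. exponent_vec k \<bullet> w = 0}"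
  obtain a e where "e > 0" "\<And>k. k \<in> Poly_Mapping.keys Q - {v} \<Longrightarrow> a \<bullet> exponent_vec (k - v) \<ge> e"
    using newton_vertex_linear_form[OF assms] by metis
  \<comment> \<open>\<open>a\<close> only shows that the open cone is nonempty; it may vanish at
    nonzero lattice points, so a generic \<open>w\<close> is taken from the cone instead.\<close>
  then have "a \<in> ?U" by force
  moreover have "open ?U"
    using open_halfspace_gt[of 0 "exponent_vec (_ - v)"]
    by (intro open_INT) (auto simp: inner_commute simp del: exponent_vec_simps)
  ultimately have "\<not> negligible ?U"
    using open_not_negligible by blast
  moreover have "negligible ?N"
    unfolding negligible_iff_null_sets
  proof (rule null_sets_UN')
    show "countable (- {0 :: 'n \<Rightarrow>\<^sub>0 int})"
      by (rule countable_subset[OF subset_UNIV countable_exponents])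
    fix k :: "'n \<Rightarrow>\<^sub>0 int" assume "k \<in> - {0}"
    then have "exponent_vec k \<noteq> 0"
      using exponent_vec_inj[of k 0] by simp
    then show "{w. exponent_vec k \<bullet> w = 0} \<in> null_sets lebesgue"
      using negligible_hyperplane[of "exponent_vec k" 0] by (auto simp only: negligible_iff_null_sets)
  qed
  ultimately have "\<not> ?U \<subseteq> ?N"
    using negligible_subset by blast
  then obtain w where w: "w \<in> ?U" "w \<notin> ?N" by blast
  show thesis
  proof (rule that[of w])
    show "k = 0" if "weight w k = 0" for k
      using w(2) that by (auto simp: inner_commute)
    show "lead_exponent w Q v"
      using w(1) newton_vertex_in_keys[OF assms] by (auto simp: lead_exponent_def inner_diff_right)
  qed
qed

section \<open>Novikov series\<close>

text \<open>On these series, multiplication by a Laurent polynomial with a leading exponent is injective;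
  this makes expansions unique.\<close>

definition novikov :: "real ^ 'n \<Rightarrow> (('n::finite \<Rightarrow>\<^sub>0 int) \<Rightarrow> rat) \<Rightarrow> bool" where
  "novikov w g \<longleftrightarrow> (\<forall>C. finite {k. g k \<noteq> 0 \<and> weight w k \<le> C})"

lemma novikov_add: "novikov w g \<Longrightarrow> novikov w h \<Longrightarrow> novikov w (\<lambda>k. g k + h k)"
  unfolding novikov_def
proof
  fix C
  assume "\<forall>C. finite {k. g k \<noteq> 0 \<and> weight w k \<le> C}"
    "\<forall>C. finite {k. h k \<noteq> 0 \<and> weight w k \<le> C}"
  then show "finite {k. g k + h k \<noteq> 0 \<and> weight w k \<le> C}"
    by - (rule finite_subset[of _ "{k. g k \<noteq> 0 \<and> weight w k \<le> C} \<union>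
        {k. h k \<noteq> 0 \<and> weight w k \<le> C}"], auto)
qed

lemma novikov_mono:
  assumes "novikov w g" "\<And>k. h k \<noteq> 0 \<Longrightarrow> g k \<noteq> 0"
  shows "novikov w h"
  unfolding novikov_def
proof
  fix C
  show "finite {k. h k \<noteq> 0 \<and> weight w k \<le> C}"
    by (rule finite_subset[of _ "{k. g k \<noteq> 0 \<and> weight w k \<le> C}"])
       (use assms in \<open>auto simp: novikov_def\<close>)
qed

lemma novikov_sum: "(\<And>a. a \<in> A \<Longrightarrow> novikov w (g a)) \<Longrightarrow> novikov w (\<lambda>k. \<Sum>a\<in>A. g a k)"
  by (induction A rule: infinite_finite_induct) (auto intro: novikov_add, auto simp: novikov_def)

lemma novikov_shift:
  assumes "novikov w g"
  shows "novikov w (\<lambda>k. g (k - l))"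
  unfolding novikov_def
proof
  fix C
  have "{k. g (k - l) \<noteq> 0 \<and> weight w k \<le> C} \<subseteq>
      (\<lambda>k. k + l) ` {k. g k \<noteq> 0 \<and> weight w k \<le> C - weight w l}"
  proof
    fix k assume "k \<in> {k. g (k - l) \<noteq> 0 \<and> weight w k \<le> C}"
    then show "k \<in> (\<lambda>k. k + l) ` {k. g k \<noteq> 0 \<and> weight w k \<le> C - weight w l}"
      by (intro image_eqI[of _ _ "k - l"]) (auto simp: inner_diff_right)
  qed
  then show "finite {k. g (k - l) \<noteq> 0 \<and> weight w k \<le> C}"
    by (rule finite_subset) (use assms in \<open>simp add: novikov_def\<close>)
qed

text \<open>The Novikov condition yields an \<open>l\<close> of least weight in the support of
  \<open>g\<close>. In the coefficient of the product at \<open>v + l\<close>, every term except the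
  one from \<open>v\<close> evaluates \<open>g\<close> at a weight below that of \<open>l\<close>,
  so a single nonzero term is left.\<close>

lemma laurent_act_eq_0:
  assumes Q: "lead_exponent w Q v" and g: "novikov w g" and 0: "\<And>k. laurent_act Q g k = 0"
  shows "g k = 0"
proof (rule ccontr)
  assume k: "g k \<noteq> 0"
  let ?A = "{l. g l \<noteq> 0 \<and> weight w l \<le> weight w k}"
  define l where "l = arg_min_on (\<lambda>l. weight w l) ?A"
  have A: "finite ?A" "?A \<noteq> {}"
    using g k by (auto simp: novikov_def)
  have l: "l \<in> ?A" "\<And>l'. l' \<in> ?A \<Longrightarrow> \<not> weight w l' < weight w l"
    using arg_min_if_finite[OF A, of "\<lambda>l. weight w l"] unfolding l_def by auto
  have z: "of_int (Poly_Mapping.lookup Q u) * g (v + l - u) = 0"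
    if "u \<in> Poly_Mapping.keys Q - {v}" for u
  proof -
    have "weight w v < weight w u"
      using that Q by (auto simp: lead_exponent_def)
    then have "weight w (v + l - u) < weight w l"
      by (simp add: inner_add_right inner_diff_right)
    then have "g (v + l - u) = 0"
      using l by force
    then show ?thesis by simp
  qed
  have "laurent_act Q g (v + l) = (\<Sum>u\<in>{v}. of_int (Poly_Mapping.lookup Q u) * g (v + l - u))"
    unfolding laurent_act_def
    by (rule sum.mono_neutral_right) (use z Q in \<open>auto simp: lead_exponent_def\<close>)
  then show False
    using 0 l(1) Q by (auto simp: lead_exponent_def in_keys_iff)
qed

section \<open>The expansion with respect to a leading exponent\<close>

text \<open>This recursion carries the weight bound, the integrality and the telescoping of the
  geometric series.\<close>

lemma lookup_geometric_ratio_power_Suc: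
  "Poly_Mapping.lookup (geometric_ratio Q v ^ Suc j) k =
     (\<Sum>l\<in>Poly_Mapping.keys Q - {v}. - (of_int (Poly_Mapping.lookup Q l) / of_int (Poly_Mapping.lookup Q v))
        * Poly_Mapping.lookup (geometric_ratio Q v ^ j) (k - (l - v)))"
  by (simp only: power_Suc geometric_ratio_def[of Q v] mult_minus_left lookup_uminus sum_distrib_right
      lookup_sum lookup_single_times sum_negf)

lemma geometric_ratio_power_weight:
  assumes "lead_exponent w Q v"
  obtains e where "e > 0"
    "\<And>j k. Poly_Mapping.lookup (geometric_ratio Q v ^ j) k \<noteq> 0 \<Longrightarrow> real j * e \<le> weight w k"
proof -
  \<comment> \<open>Inserting 1 keeps the minimum defined and positive when \<open>Q\<close> is a
    single monomial.\<close>
  let ?K = "insert 1 ((\<lambda>k. weight w (k - v)) ` (Poly_Mapping.keys Q - {v}))"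
  define e where "e = Min ?K"
  have "e > 0"
    using assms by (simp add: e_def lead_exponent_def inner_diff_right)
  have e: "e \<le> weight w (k - v)" if "k \<in> Poly_Mapping.keys Q - {v}" for k
    using that unfolding e_def by (intro Min_le) auto
  have "real j * e \<le> weight w k" if "Poly_Mapping.lookup (geometric_ratio Q v ^ j) k \<noteq> 0" for j k
    using that
  proof (induction j arbitrary: k)
    case 0
    then show ?case by (auto simp: lookup_one when_def split: if_splits)
  next
    case (Suc j)
    then obtain l where l: "l \<in> Poly_Mapping.keys Q - {v}"
      "Poly_Mapping.lookup (geometric_ratio Q v ^ j) (k - (l - v)) \<noteq> 0"
      unfolding lookup_geometric_ratio_power_Suc by (metis (no_types, lifting) mult_zero_right sum.neutral)
    then show ?case
      using Suc.IH[OF l(2)] e[OF l(1)] by (simp add: inner_diff_right algebra_simps)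
  qed
  with \<open>e > 0\<close> show thesis by (rule that)
qed

text \<open>One cutoff for all exponents of weight at most \<open>C\<close>, rather than one per
  exponent, allows the sum over \<open>j\<close> to be interchanged with a sum over shifted
  exponents.\<close>

lemma inverse_expansion_finite_sum:
  assumes "lead_exponent w Q v"
  obtains J :: "real \<Rightarrow> nat" where
    "\<And>j k C. weight w k \<le> C \<Longrightarrow> J C \<le> j \<Longrightarrow> Poly_Mapping.lookup (geometric_ratio Q v ^ j) k = 0"
    "\<And>k C. weight w k \<le> C \<Longrightarrow> inverse_expansion Q v k = 1 / of_int (Poly_Mapping.lookup Q v) *
       (\<Sum>j<J C. Poly_Mapping.lookup (geometric_ratio Q v ^ j) k)"
proof -
  obtain e where e: "e > 0"
    "\<And>j k. Poly_Mapping.lookup (geometric_ratio Q v ^ j) k \<noteq> 0 \<Longrightarrow> real j * e \<le> weight w k"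
    using geometric_ratio_power_weight[OF assms] by metis
  define J where "J C = nat (\<lceil>C / e\<rceil> + 1)" for C
  have z: "Poly_Mapping.lookup (geometric_ratio Q v ^ j) k = 0"
    if "weight w k \<le> C" "J C \<le> j" for j k C
  proof (rule ccontr)
    assume "Poly_Mapping.lookup (geometric_ratio Q v ^ j) k \<noteq> 0"
    then have "real j * e \<le> C"
      using e(2) that by force
    then have "real j \<le> C / e"
      using e(1) by (simp add: field_simps)
    then show False
      using that(2) unfolding J_def by linarith
  qed
  show thesis
  proof (rule that[of J])
    fix k C assume k: "weight w k \<le> C"
    have "Sum_any (\<lambda>j. Poly_Mapping.lookup (geometric_ratio Q v ^ j) k) =
        (\<Sum>j<J C. Poly_Mapping.lookup (geometric_ratio Q v ^ j) k)"
      by (rule Sum_any.expand_superset) (use z[OF k] in \<open>auto simp: not_le[symmetric]\<close>)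
    then show "inverse_expansion Q v k = 1 / of_int (Poly_Mapping.lookup Q v) *
       (\<Sum>j<J C. Poly_Mapping.lookup (geometric_ratio Q v ^ j) k)"
      by (simp add: inverse_expansion_def)
  qed (use z in blast)
qed

lemma novikov_inverse_expansion:
  assumes "lead_exponent w Q v"
  shows "novikov w (inverse_expansion Q v)"
  unfolding novikov_def
proof
  fix C
  obtain J where J: "\<And>k C. weight w k \<le> C \<Longrightarrow> inverse_expansion Q v k =
      1 / of_int (Poly_Mapping.lookup Q v) *
       (\<Sum>j<J C. Poly_Mapping.lookup (geometric_ratio Q v ^ j) k)"
    using inverse_expansion_finite_sum[OF assms] by metis
  have "{k. inverse_expansion Q v k \<noteq> 0 \<and> weight w k \<le> C} \<subseteq>
      (\<Union>j<J C. Poly_Mapping.keys (geometric_ratio Q v ^ j))"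
  proof
    fix k assume "k \<in> {k. inverse_expansion Q v k \<noteq> 0 \<and> weight w k \<le> C}"
    then have "(\<Sum>j<J C. Poly_Mapping.lookup (geometric_ratio Q v ^ j) k) \<noteq> 0"
      using J[of k C] by auto
    then show "k \<in> (\<Union>j<J C. Poly_Mapping.keys (geometric_ratio Q v ^ j))"
      by (meson UN_I in_keys_iff sum.neutral)
  qed
  then show "finite {k. inverse_expansion Q v k \<noteq> 0 \<and> weight w k \<le> C}"
    by (rule finite_subset) simp
qed

text \<open>Multiplication by \<open>Q = q\<^sub>v x\<^sup>v (1 - R)\<close> makes the geometric sum
  telescope; its end terms are \<open>R ^ 0\<close> and a power of \<open>R\<close> past the
  cutoff.\<close>

lemma laurent_act_inverse_expansion:
  assumes Q: "lead_exponent w Q v"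
  shows "laurent_act Q (inverse_expansion Q v) k = (if k = v then 1 else 0)"
proof -
  obtain J :: "real \<Rightarrow> nat" where
    z: "\<And>j k C. weight w k \<le> C \<Longrightarrow> J C \<le> j \<Longrightarrow> Poly_Mapping.lookup (geometric_ratio Q v ^ j) k = 0" and
    J: "\<And>k C. weight w k \<le> C \<Longrightarrow> inverse_expansion Q v k = 1 / of_int (Poly_Mapping.lookup Q v) *
       (\<Sum>j<J C. Poly_Mapping.lookup (geometric_ratio Q v ^ j) k)"
    using inverse_expansion_finite_sum[OF Q] by metis
  let ?q = "\<lambda>l. of_int (Poly_Mapping.lookup Q l) :: rat"
  let ?R = "\<lambda>j k. Poly_Mapping.lookup (geometric_ratio Q v ^ j) k"
  \<comment> \<open>Among the \<open>k - l\<close> with \<open>l\<close> in the support of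
    \<open>Q\<close>, the weight is largest at \<open>l = v\<close>, so one cutoff serves all of
    them.\<close>
  let ?C = "weight w (k - v)"
  have v: "v \<in> Poly_Mapping.keys Q" "?q v \<noteq> 0"
    using Q by (auto simp: lead_exponent_def in_keys_iff)
  have le: "weight w (k - l) \<le> ?C" if "l \<in> Poly_Mapping.keys Q" for l
    using that Q by (cases "l = v") (auto simp: lead_exponent_def inner_diff_right dest!: bspec[of _ _ l])
  have "laurent_act Q (inverse_expansion Q v) k =
      (\<Sum>l\<in>Poly_Mapping.keys Q. ?q l * (1 / ?q v * (\<Sum>j<J ?C. ?R j (k - l))))"
    unfolding laurent_act_def using J[OF le] by (intro sum.cong) auto
  also have "\<dots> = (\<Sum>j<J ?C. \<Sum>l\<in>Poly_Mapping.keys Q. ?q l / ?q v * ?R j (k - l))"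
    by (subst sum.swap) (simp add: sum_distrib_left)
  also have "\<dots> = (\<Sum>j<J ?C. ?R j (k - v) - ?R (Suc j) (k - v))"
  proof (rule sum.cong[OF refl])
    fix j
    have "(\<Sum>l\<in>Poly_Mapping.keys Q. ?q l / ?q v * ?R j (k - l)) =
        ?R j (k - v) + (\<Sum>l\<in>Poly_Mapping.keys Q - {v}. ?q l / ?q v * ?R j (k - l))"
      using v by (simp add: sum.remove[of _ v])
    also have "(\<Sum>l\<in>Poly_Mapping.keys Q - {v}. ?q l / ?q v * ?R j (k - l)) = - ?R (Suc j) (k - v)"
      unfolding lookup_geometric_ratio_power_Suc by (simp add: sum_negf algebra_simps)
    finally show "(\<Sum>l\<in>Poly_Mapping.keys Q. ?q l / ?q v * ?R j (k - l)) = ?R j (k - v) - ?R (Suc j) (k - v)"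
      by simp
  qed
  also have "\<dots> = ?R 0 (k - v) - ?R (J ?C) (k - v)"
    by (rule sum_lessThan_telescope')
  also have "?R (J ?C) (k - v) = 0"
    by (rule z[of _ ?C]) auto
  finally show ?thesis
    by (simp add: lookup_one when_def)
qed

lemma novikov_laurent_expansion:
  assumes "lead_exponent w Q v"
  shows "novikov w (laurent_expansion P Q v)"
  unfolding laurent_expansion_def
proof (rule novikov_sum)
  fix l
  show "novikov w (\<lambda>k. of_int (Poly_Mapping.lookup P l) * inverse_expansion Q v (k - (l - v)))"
    by (rule novikov_mono[OF novikov_shift[OF novikov_inverse_expansion[OF assms], of "l - v"]])
       (metis mult_zero_right)
qed

lemma laurent_act_laurent_expansion:
  assumes "lead_exponent w Q v"
  shows "laurent_act Q (laurent_expansion P Q v) k = of_int (Poly_Mapping.lookup P k)"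
proof -
  \<comment> \<open>The expansion is the Laurent polynomial \<open>P x^(-v)\<close> acting on the
    series \<open>x^v / Q\<close>, and the action of \<open>Q\<close> commutes with this.\<close>
  have "laurent_expansion P Q v =
      laurent_act (P * Poly_Mapping.single (- v) 1) (inverse_expansion Q v)"
  proof
    fix k
    have "k - (l - v) = k - l - (- v)" for l
      by (simp only: diff_diff_eq2 diff_minus_eq_add diff_add_eq)
    then show "laurent_expansion P Q v k =
        laurent_act (P * Poly_Mapping.single (- v) 1) (inverse_expansion Q v) k"
      by (simp only: laurent_act_mult laurent_act_def[of P] laurent_expansion_def laurent_act_single
          of_int_1 mult_1)
  qed
  then have "laurent_act Q (laurent_expansion P Q v) =
      laurent_act (P * Poly_Mapping.single (- v) 1) (laurent_act Q (inverse_expansion Q v))"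
    by (simp only: laurent_act_mult[symmetric] mult.commute)
  also have "\<dots> = laurent_act P (\<lambda>k. if k = 0 then 1 else 0)"
  proof -
    have "k - - v = v \<longleftrightarrow> k = 0" for k
      by (simp only: diff_minus_eq_add add_cancel_left_left)
    then have "laurent_act (Poly_Mapping.single (- v) 1) (laurent_act Q (inverse_expansion Q v)) =
        (\<lambda>k. if k = 0 then 1 else 0)"
      by (intro ext)
         (simp only: laurent_act_single laurent_act_inverse_expansion[OF assms] of_int_1 mult_1)
    then show ?thesis
      by (simp only: laurent_act_mult)
  qed
  finally have "laurent_act Q (laurent_expansion P Q v) k = laurent_act P (\<lambda>k. if k = 0 then 1 else 0) k"
    by simp
  also have "\<dots> = of_int (Poly_Mapping.lookup P k)"
    by (simp add: laurent_act_def if_distrib[of "\<lambda>x. _ * x"] in_keys_iff cong: if_cong)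
  finally show ?thesis .
qed

section \<open>Integrality\<close>

lemma p_integral_of_int [simp]: "prime p \<Longrightarrow> p_integral p (of_int a)"
  unfolding p_integral_def by (rule exI[of _ a], rule exI[of _ 1]) (auto simp: prime_nat_iff)

lemma p_integral_0 [simp]: "prime p \<Longrightarrow> p_integral p 0"
  using p_integral_of_int[of p 0] by simp

lemma p_integral_1 [simp]: "prime p \<Longrightarrow> p_integral p 1"
  using p_integral_of_int[of p 1] by simp

lemma p_integral_add:
  assumes "prime p" "p_integral p a" "p_integral p b"
  shows "p_integral p (a + b)"
proof -
  obtain x y x' y' where "\<not> int p dvd y" "\<not> int p dvd y'"
    "a = of_int x / of_int y" "b = of_int x' / of_int y'"
    using assms unfolding p_integral_def by blast
  moreover from this have "y \<noteq> 0" "y' \<noteq> 0" by auto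
  ultimately show ?thesis unfolding p_integral_def using assms(1)
    by (intro exI[of _ "x * y' + x' * y"] exI[of _ "y * y'"])
       (simp add: add_frac_eq prime_dvd_mult_iff)
qed

lemma p_integral_mult:
  assumes "prime p" "p_integral p a" "p_integral p b"
  shows "p_integral p (a * b)"
proof -
  obtain x y x' y' where "\<not> int p dvd y" "\<not> int p dvd y'"
    "a = of_int x / of_int y" "b = of_int x' / of_int y'"
    using assms unfolding p_integral_def by blast
  then show ?thesis unfolding p_integral_def using assms(1)
    by (intro exI[of _ "x * x'"] exI[of _ "y * y'"])
       (simp add: prime_dvd_mult_iff)
qed

lemma p_integral_uminus: "prime p \<Longrightarrow> p_integral p a \<Longrightarrow> p_integral p (- a)"
  using p_integral_mult[OF _ p_integral_of_int[of p "- 1"], of a] by simp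

lemma p_integral_sum: "prime p \<Longrightarrow> (\<And>a. a \<in> A \<Longrightarrow> p_integral p (g a)) \<Longrightarrow> p_integral p (sum g A)"
  by (induction A rule: infinite_finite_induct) (auto intro: p_integral_add)

text \<open>By the recursion for the powers of the ratio, the only number ever divided by is the
  leading coefficient of \<open>Q\<close>.\<close>

lemma p_integral_laurent_expansion:
  assumes "prime p" "lead_exponent w Q v" "\<not> int p dvd Poly_Mapping.lookup Q v"
  shows "p_integral p (laurent_expansion P Q v k)"
proof -
  have div: "p_integral p (of_int a / of_int (Poly_Mapping.lookup Q v))" for a
    using assms(3) unfolding p_integral_def by blast
  have pow: "p_integral p (Poly_Mapping.lookup (geometric_ratio Q v ^ j) k)" for j k
  proof (induction j arbitrary: k)
    case 0
    then show ?case using assms(1) by (simp add: lookup_one when_def)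
  next
    case (Suc j)
    then show ?case unfolding lookup_geometric_ratio_power_Suc using assms(1) div
      by (intro p_integral_sum p_integral_mult p_integral_uminus) auto
  qed
  obtain J where J: "\<And>k C. weight w k \<le> C \<Longrightarrow> inverse_expansion Q v k =
      1 / of_int (Poly_Mapping.lookup Q v) *
       (\<Sum>j<J C. Poly_Mapping.lookup (geometric_ratio Q v ^ j) k)"
    using inverse_expansion_finite_sum[OF assms(2)] by metis
  have "p_integral p (inverse_expansion Q v k)" for k
    unfolding J[OF order.refl] using assms(1) div[of 1] pow
    by (intro p_integral_mult p_integral_sum) auto
  then show ?thesis
    unfolding laurent_expansion_def using assms(1)
    by (intro p_integral_sum p_integral_mult) auto
qed

text \<open>Characteristic zero permits division by \<open>n\<close> in the logarithm and
  cancellation of \<open>p\<close> and of 2.\<close>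

instance fract :: ("{idom, ring_char_0}") field_char_0
proof
  show "inj (of_nat :: nat \<Rightarrow> 'a fract)"
    by (rule injI) (simp add: of_nat_fract eq_fract)
qed

section \<open>The Euler derivations\<close>

definition laurent_theta :: "'n \<Rightarrow> ('n, int) laurent \<Rightarrow> ('n, int) laurent" where
  "laurent_theta i P = Poly_Mapping.single (Poly_Mapping.single i 1) 1 * laurent_pderiv i P"

lemma lookup_laurent_theta:
  "Poly_Mapping.lookup (laurent_theta i P) k = Poly_Mapping.lookup k i * Poly_Mapping.lookup P k"
  unfolding laurent_theta_def lookup_single_times lookup_laurent_pderiv
  by (simp only: diff_add_cancel lookup_minus lookup_single_eq mult_1)

lemma laurent_theta_mult:
  "laurent_theta i (P * Q) = laurent_theta i P * Q + P * laurent_theta i Q"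
  by (simp add: laurent_theta_def laurent_pderiv_mult algebra_simps)

lemma laurent_theta_add: "laurent_theta i (P + Q) = laurent_theta i P + laurent_theta i Q"
  by (simp add: laurent_theta_def laurent_pderiv_add algebra_simps)

lemma laurent_theta_commute:
  "laurent_theta i (laurent_theta j P) = laurent_theta j (laurent_theta i P)"
  by (rule poly_mapping_eqI) (simp add: lookup_laurent_theta)

lemma keys_laurent_theta: "Poly_Mapping.keys (laurent_theta i P) \<subseteq> Poly_Mapping.keys P"
  by (auto simp: in_keys_iff lookup_laurent_theta)

lemma theta_Fract:
  assumes "Q \<noteq> 0"
  shows "theta i (Fract P Q) = Fract (laurent_theta i P * Q - P * laurent_theta i Q) (Q * Q)"
  by (simp add: theta_def ratfun_var_def ratfun_pderiv_Fract[OF assms] laurent_theta_def algebra_simps)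

lemma theta_add: "theta i (F + G) = theta i F + theta i G"
proof (cases F, cases G)
  fix P Q R S assume FG: "F = Fract P Q" "Q \<noteq> 0" "G = Fract R S" "S \<noteq> 0"
  show ?thesis
    using FG(2,4) unfolding FG(1,3)
    by (simp add: theta_Fract eq_fract laurent_theta_mult laurent_theta_add algebra_simps)
qed

lemma theta_mult: "theta i (F * G) = theta i F * G + F * theta i G"
proof (cases F, cases G)
  fix P Q R S assume FG: "F = Fract P Q" "Q \<noteq> 0" "G = Fract R S" "S \<noteq> 0"
  show ?thesis
    using FG(2,4) unfolding FG(1,3)
    by (simp add: theta_Fract eq_fract laurent_theta_mult algebra_simps)
qed

lemma theta_0 [simp]: "theta i 0 = 0"
  using theta_add[of i 0 0] by simp

lemma theta_1 [simp]: "theta i 1 = 0"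
  using theta_mult[of i 1 1] by simp

lemma theta_sum: "theta i (sum F A) = (\<Sum>a\<in>A. theta i (F a))"
  by (induction A rule: infinite_finite_induct) (auto simp: theta_add)

lemma theta_of_nat [simp]: "theta i (of_nat n) = 0"
  by (induction n) (auto simp: theta_add)

lemma theta_uminus: "theta i (- F) = - theta i F"
  using theta_add[of i F "- F"] by (simp add: eq_neg_iff_add_eq_0 add.commute)

lemma theta_diff: "theta i (F - G) = theta i F - theta i G"
  using theta_add[of i F "- G"] by (simp add: theta_uminus)

lemma theta_of_int [simp]: "theta i (of_int n) = 0"
  by (cases n) (auto simp: theta_uminus simp del: of_nat_Suc)

lemma theta_power: "theta i (F ^ n) = of_nat n * F ^ (n - 1) * theta i F"
proof (induction n)
  case (Suc n)
  then show ?case by (cases n) (auto simp: theta_mult algebra_simps)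
qed simp

lemma theta_prod:
  assumes "finite A"
  shows "theta i (prod F A) = (\<Sum>a\<in>A. theta i (F a) * prod F (A - {a}))"
  using assms
proof (induction A rule: finite_induct)
  case (insert a A)
  have "prod F (insert a A - {b}) = F a * prod F (A - {b})" if "b \<in> A" for b
  proof -
    have "insert a A - {b} = insert a (A - {b})" using insert that by auto
    then show ?thesis using insert by simp
  qed
  then have "(\<Sum>b\<in>A. theta i (F b) * prod F (insert a A - {b})) = F a * theta i (prod F A)"
    using insert by (auto simp: sum_distrib_left algebra_simps intro!: sum.cong)
  then show ?case
    using insert by (simp add: theta_mult algebra_simps)
qed simp

lemma theta_divide:
  assumes "G \<noteq> 0"
  shows "theta i (F / G) = theta i F / G - F * theta i G / (G * G)"
proof -
  have "theta i (F / G) * G + F / G * theta i G = theta i F"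
    using assms theta_mult[of i "F / G" G] by simp
  then show ?thesis
    using assms by (simp add: field_simps)
qed

text \<open>On Laurent polynomials both orders scale a coefficient by the same two components of its
  exponent. Applied to \<open>F * q = p\<close>, the product rule leaves cross terms that are
  symmetric in \<open>i\<close> and \<open>j\<close>, and \<open>q\<close> cancels.\<close>

lemma theta_commute: "theta i (theta j F) = theta j (theta i F)"
proof -
  have poly: "theta i (theta j (Fract P 1)) = theta j (theta i (Fract P 1))" for P i j
    by (simp add: theta_Fract laurent_theta_mult laurent_theta_commute[of i j] laurent_theta_def[of _ 1]
        laurent_pderiv_def)
  obtain P Q where F: "F = Fract P Q" "Q \<noteq> 0"
    by (cases F) auto
  define p q where "p = Fract P 1" and "q = Fract Q 1"
  have q: "q \<noteq> 0"
    using F(2) by (simp add: q_def Zero_fract_def eq_fract)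
  have "F * q = p"
    using F by (simp add: p_def q_def eq_fract)
  then have "theta i (theta j (F * q)) = theta j (theta i (F * q))"
    using poly by (simp add: p_def)
  then have "theta i (theta j F) * q = theta j (theta i F) * q"
    using poly[of i j Q] by (simp add: theta_mult theta_add q_def[symmetric] algebra_simps)
  then show ?thesis
    using q by simp
qed

section \<open>The Frobenius lift\<close>

definition laurent_frob :: "nat \<Rightarrow> ('n, int) laurent \<Rightarrow> ('n, int) laurent" where
  "laurent_frob p P = (\<Sum>k\<in>Poly_Mapping.keys P.
     Poly_Mapping.single (frag_cmul (int p) k) (Poly_Mapping.lookup P k))"

lemma laurent_frob_superset:
  assumes "finite A" "Poly_Mapping.keys P \<subseteq> A"
  shows "laurent_frob p P =
    (\<Sum>k\<in>A. Poly_Mapping.single (frag_cmul (int p) k) (Poly_Mapping.lookup P k))"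
  unfolding laurent_frob_def using assms
  by (intro sum.mono_neutral_left) (auto simp: in_keys_iff)

lemma laurent_frob_0 [simp]: "laurent_frob p 0 = 0"
  by (simp add: laurent_frob_def)

lemma laurent_frob_add: "laurent_frob p (P + Q) = laurent_frob p P + laurent_frob p Q"
proof -
  let ?A = "Poly_Mapping.keys P \<union> Poly_Mapping.keys Q"
  have "Poly_Mapping.keys (P + Q) \<subseteq> ?A"
    by (rule keys_add)
  then show ?thesis
    by (simp add: laurent_frob_superset[of ?A] lookup_add single_add sum.distrib)
qed

lemma laurent_frob_uminus: "laurent_frob p (- P) = - laurent_frob p P"
  using laurent_frob_add[of p P "- P"] by (simp add: eq_neg_iff_add_eq_0 add.commute)

lemma laurent_frob_diff: "laurent_frob p (P - Q) = laurent_frob p P - laurent_frob p Q"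
  using laurent_frob_add[of p P "- Q"] by (simp add: laurent_frob_uminus)

lemma laurent_frob_sum: "laurent_frob p (sum F A) = (\<Sum>a\<in>A. laurent_frob p (F a))"
  by (induction A rule: infinite_finite_induct) (auto simp: laurent_frob_add)

lemma laurent_frob_single:
  "laurent_frob p (Poly_Mapping.single k c) = Poly_Mapping.single (frag_cmul (int p) k) c"
  by (cases "c = 0") (auto simp: laurent_frob_def)

lemma laurent_frob_1 [simp]: "laurent_frob p 1 = 1"
  using laurent_frob_single[of p 0 1] by simp

lemma laurent_frob_mult: "laurent_frob p (P * Q) = laurent_frob p P * laurent_frob p Q"
proof -
  let ?A = "Poly_Mapping.keys P" and ?B = "Poly_Mapping.keys Q"
  let ?p = "\<lambda>k. Poly_Mapping.single k (Poly_Mapping.lookup P k)"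
  let ?q = "\<lambda>k. Poly_Mapping.single k (Poly_Mapping.lookup Q k)"
  have "laurent_frob p (sum ?p ?A * sum ?q ?B) = laurent_frob p (sum ?p ?A) * laurent_frob p (sum ?q ?B)"
    by (simp only: sum_product laurent_frob_sum laurent_frob_single mult_single frag_cmul_distrib2)
  then show ?thesis
    by (simp only: laurent_sum_singles[symmetric])
qed

lemma inj_frag_cmul: "n \<noteq> 0 \<Longrightarrow> inj (frag_cmul n)"
  by (rule injI) (auto simp: poly_mapping_eq_iff fun_eq_iff)

lemma lookup_laurent_frob:
  assumes "p > 0"
  shows "Poly_Mapping.lookup (laurent_frob p P) (frag_cmul (int p) k) = Poly_Mapping.lookup P k"
proof -
  have eq: "frag_cmul (int p) l = frag_cmul (int p) k \<longleftrightarrow> l = k" for l k :: "'a \<Rightarrow>\<^sub>0 int"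
    using inj_frag_cmul[of "int p"] assms by (auto dest: injD)
  show ?thesis
    by (simp add: laurent_frob_def lookup_sum lookup_single when_def eq in_keys_iff)
qed

lemma keys_laurent_frob:
  assumes "p > 0"
  shows "Poly_Mapping.keys (laurent_frob p P) = frag_cmul (int p) ` Poly_Mapping.keys P"
proof
  show "Poly_Mapping.keys (laurent_frob p P) \<subseteq> frag_cmul (int p) ` Poly_Mapping.keys P"
    unfolding laurent_frob_def
    by (rule order.trans[OF keys_sum]) (auto split: if_splits)
qed (auto simp: in_keys_iff lookup_laurent_frob[OF assms])

lemma laurent_frob_eq_0_iff [simp]: "p > 0 \<Longrightarrow> laurent_frob p P = 0 \<longleftrightarrow> P = 0"
  using keys_laurent_frob[of p P] by (metis image_is_empty keys_eq_empty)

lemma lookup_of_nat_times: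
  fixes P :: "('n, int) laurent"
  shows "Poly_Mapping.lookup (of_nat n * P) k = int n * Poly_Mapping.lookup P k"
proof -
  have "of_nat n = (Poly_Mapping.single 0 (int n) :: ('n, int) laurent)"
    by (rule single_of_nat[symmetric])
  then show ?thesis
    by (simp only: lookup_single_times diff_zero)
qed

text \<open>An exponent of the image is \<open>p\<close> times an old one, so the Euler operator
  gains a factor \<open>p\<close>. This factor is cancelled when a logarithmic derivative is
  compared with its Frobenius image.\<close>

lemma laurent_theta_frob:
  assumes "p > 0"
  shows "laurent_theta i (laurent_frob p P) = of_nat p * laurent_frob p (laurent_theta i P)"
proof (rule poly_mapping_eqI)
  fix k
  show "Poly_Mapping.lookup (laurent_theta i (laurent_frob p P)) k =
      Poly_Mapping.lookup (of_nat p * laurent_frob p (laurent_theta i P)) k"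
  proof (cases "k \<in> range (frag_cmul (int p))")
    case True
    then obtain l where "k = frag_cmul (int p) l"
      by blast
    then show ?thesis
      by (simp add: lookup_of_nat_times lookup_laurent_theta lookup_laurent_frob[OF assms])
  next
    case False
    then have "k \<notin> Poly_Mapping.keys (laurent_frob p Q)" for Q
      by (auto simp: keys_laurent_frob[OF assms])
    then show ?thesis
      by (simp add: lookup_of_nat_times lookup_laurent_theta in_keys_iff)
  qed
qed

lemma lead_exponent_frob:
  assumes "p > 0" "lead_exponent w Q v"
  shows "lead_exponent w (laurent_frob p Q) (frag_cmul (int p) v)"
  using assms by (auto simp: lead_exponent_def keys_laurent_frob)

definition ratfun_frob :: "nat \<Rightarrow> 'n::{finite,linorder} ratfun \<Rightarrow> 'n ratfun" where
  "ratfun_frob p F = (THE D. \<exists>P Q. Q \<noteq> 0 \<and> F = Fract P Q \<and>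
     D = Fract (laurent_frob p P) (laurent_frob p Q))"

text \<open>Cross-multiplied equations survive because \<open>laurent_frob\<close> is
  multiplicative, and denominators stay nonzero because \<open>p > 0\<close> makes it
  injective.\<close>

lemma ratfun_frob_Fract:
  fixes P Q :: "('n::{finite,linorder}, int) laurent"
  assumes "p > 0" "Q \<noteq> 0"
  shows "ratfun_frob p (Fract P Q) = Fract (laurent_frob p P) (laurent_frob p Q)"
  unfolding ratfun_frob_def
proof (rule the_equality)
  fix D
  assume "\<exists>P' Q'. Q' \<noteq> 0 \<and> Fract P Q = Fract P' Q' \<and>
    D = Fract (laurent_frob p P') (laurent_frob p Q')"
  then obtain P' Q' where "Q' \<noteq> 0" "P * Q' = P' * Q"
    "D = Fract (laurent_frob p P') (laurent_frob p Q')"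
    using assms by (auto simp: eq_fract)
  then show "D = Fract (laurent_frob p P) (laurent_frob p Q)"
    using assms by (simp add: eq_fract flip: laurent_frob_mult)
qed (use assms in blast)

lemma ratfun_frob_add: "p > 0 \<Longrightarrow> ratfun_frob p (F + G) = ratfun_frob p F + ratfun_frob p G"
  by (cases F; cases G) (simp add: ratfun_frob_Fract laurent_frob_add laurent_frob_mult)

lemma ratfun_frob_mult: "p > 0 \<Longrightarrow> ratfun_frob p (F * G) = ratfun_frob p F * ratfun_frob p G"
  by (cases F; cases G) (simp add: ratfun_frob_Fract laurent_frob_mult)

lemma ratfun_frob_0 [simp]: "p > 0 \<Longrightarrow> ratfun_frob p 0 = 0"
  using ratfun_frob_add[of p 0 0] by simp

lemma ratfun_frob_1 [simp]: "p > 0 \<Longrightarrow> ratfun_frob p 1 = 1"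
  by (simp add: One_fract_def ratfun_frob_Fract)

lemma ratfun_frob_uminus: "p > 0 \<Longrightarrow> ratfun_frob p (- F) = - ratfun_frob p F"
  using ratfun_frob_add[of p F "- F"] by (simp add: eq_neg_iff_add_eq_0 add.commute)

lemma ratfun_frob_diff: "p > 0 \<Longrightarrow> ratfun_frob p (F - G) = ratfun_frob p F - ratfun_frob p G"
  using ratfun_frob_add[of p F "- G"] by (simp add: ratfun_frob_uminus)

lemma ratfun_frob_sum: "p > 0 \<Longrightarrow> ratfun_frob p (sum F A) = (\<Sum>a\<in>A. ratfun_frob p (F a))"
  by (induction A rule: infinite_finite_induct) (auto simp: ratfun_frob_add)

lemma ratfun_frob_prod: "p > 0 \<Longrightarrow> ratfun_frob p (prod F A) = (\<Prod>a\<in>A. ratfun_frob p (F a))"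
  by (induction A rule: infinite_finite_induct) (auto simp: ratfun_frob_mult)

lemma ratfun_frob_divide: "p > 0 \<Longrightarrow> G \<noteq> 0 \<Longrightarrow> ratfun_frob p (F / G) = ratfun_frob p F / ratfun_frob p G"
  by (cases F; cases G)
     (simp add: ratfun_frob_Fract laurent_frob_mult Zero_fract_def eq_fract)

lemma theta_frob:
  assumes "p > 0"
  shows "theta i (ratfun_frob p F) = of_nat p * ratfun_frob p (theta i F)"
proof -
  obtain P Q where F: "F = Fract P Q" "Q \<noteq> 0"
    by (cases F) auto
  show ?thesis
    using F(2) assms unfolding F(1) of_nat_fract
    by (simp add: ratfun_frob_Fract theta_Fract laurent_theta_frob laurent_frob_mult laurent_frob_diff
        algebra_simps)
qed

section \<open>Rational functions with p-integral expansion\<close>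

text \<open>The condition asks for one good fraction instead of speaking about coefficients of a
  series. It suffices for an integral expansion, and its closure properties follow from the
  multiplicativity of leading coefficients without leaving the field.\<close>

definition p_integral_ratfun :: "real ^ 'n::{finite,linorder} \<Rightarrow> nat \<Rightarrow> 'n ratfun \<Rightarrow> bool" where
  "p_integral_ratfun w p F \<longleftrightarrow> (\<exists>P Q v. lead_exponent w Q v \<and>
     \<not> int p dvd Poly_Mapping.lookup Q v \<and> F = Fract P Q)"

lemma lead_exponent_single: "c \<noteq> 0 \<Longrightarrow> lead_exponent w (Poly_Mapping.single k c) k"
  by (simp add: lead_exponent_def)

context
  fixes w :: "real ^ 'n::{finite,linorder}" and p :: nat
  assumes p: "prime p"
begin

lemma p_integral_ratfun_laurent: "p_integral_ratfun w p (Fract P 1)"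
proof -
  have "lead_exponent w 1 (0 :: 'n \<Rightarrow>\<^sub>0 int)"
    using lead_exponent_single[of 1 w 0] by simp
  then show ?thesis
    unfolding p_integral_ratfun_def using p not_prime_unit
    by (intro exI[of _ P] exI[of _ 1] exI[of _ 0]) (auto simp: lookup_one)
qed

lemma p_integral_ratfun_of_int: "p_integral_ratfun w p (of_int n)"
proof -
  have "of_int n = Fract (of_int n :: ('n, int) laurent) 1"
    by (cases n) (auto simp: of_nat_fract One_fract_def simp del: of_nat_Suc)
  then show ?thesis
    using p_integral_ratfun_laurent by metis
qed

lemma p_integral_ratfun_of_nat: "p_integral_ratfun w p (of_nat n)"
  using p_integral_ratfun_of_int[of "int n"] by simp

lemma p_integral_ratfun_0: "p_integral_ratfun w p 0"
  using p_integral_ratfun_of_int[of 0] by simp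

lemma p_integral_ratfun_1: "p_integral_ratfun w p 1"
  using p_integral_ratfun_of_int[of 1] by simp

lemma p_integral_ratfun_add:
  assumes "p_integral_ratfun w p F" "p_integral_ratfun w p G"
  shows "p_integral_ratfun w p (F + G)"
proof -
  obtain P Q u where F: "lead_exponent w Q u" "\<not> int p dvd Poly_Mapping.lookup Q u" "F = Fract P Q"
    using assms(1) by (auto simp: p_integral_ratfun_def)
  obtain R S v where G: "lead_exponent w S v" "\<not> int p dvd Poly_Mapping.lookup S v" "G = Fract R S"
    using assms(2) by (auto simp: p_integral_ratfun_def)
  have "F + G = Fract (P * S + R * Q) (Q * S)"
    using F(3) G(3) lead_exponent_nonzero[OF F(1)] lead_exponent_nonzero[OF G(1)] by simp
  moreover have "lead_exponent w (Q * S) (u + v)" "\<not> int p dvd Poly_Mapping.lookup (Q * S) (u + v)"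
    using lead_exponent_mult[OF F(1) G(1)] F(2) G(2) p by (simp_all add: prime_dvd_mult_iff)
  ultimately show ?thesis
    unfolding p_integral_ratfun_def by blast
qed

lemma p_integral_ratfun_mult:
  assumes "p_integral_ratfun w p F" "p_integral_ratfun w p G"
  shows "p_integral_ratfun w p (F * G)"
proof -
  obtain P Q u where F: "lead_exponent w Q u" "\<not> int p dvd Poly_Mapping.lookup Q u" "F = Fract P Q"
    using assms(1) by (auto simp: p_integral_ratfun_def)
  obtain R S v where G: "lead_exponent w S v" "\<not> int p dvd Poly_Mapping.lookup S v" "G = Fract R S"
    using assms(2) by (auto simp: p_integral_ratfun_def)
  have "F * G = Fract (P * R) (Q * S)"
    using F G by simp
  moreover have "lead_exponent w (Q * S) (u + v)" "\<not> int p dvd Poly_Mapping.lookup (Q * S) (u + v)"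
    using lead_exponent_mult[OF F(1) G(1)] F(2) G(2) p by (simp_all add: prime_dvd_mult_iff)
  ultimately show ?thesis
    unfolding p_integral_ratfun_def by blast
qed

lemma p_integral_ratfun_uminus: "p_integral_ratfun w p F \<Longrightarrow> p_integral_ratfun w p (- F)"
  using p_integral_ratfun_mult[OF p_integral_ratfun_of_int[of "- 1"], of F] by simp

lemma p_integral_ratfun_diff:
  "p_integral_ratfun w p F \<Longrightarrow> p_integral_ratfun w p G \<Longrightarrow> p_integral_ratfun w p (F - G)"
  using p_integral_ratfun_add[of F "- G"] p_integral_ratfun_uminus[of G] by simp

lemma p_integral_ratfun_sum:
  "(\<And>a. a \<in> A \<Longrightarrow> p_integral_ratfun w p (F a)) \<Longrightarrow> p_integral_ratfun w p (sum F A)"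
proof (induction A rule: infinite_finite_induct)
qed (simp_all add: p_integral_ratfun_add p_integral_ratfun_0)

lemma p_integral_ratfun_prod:
  "(\<And>a. a \<in> A \<Longrightarrow> p_integral_ratfun w p (F a)) \<Longrightarrow> p_integral_ratfun w p (prod F A)"
proof (induction A rule: infinite_finite_induct)
qed (simp_all add: p_integral_ratfun_mult p_integral_ratfun_1)

lemma p_integral_ratfun_power: "p_integral_ratfun w p F \<Longrightarrow> p_integral_ratfun w p (F ^ n)"
  by (induction n) (auto intro: p_integral_ratfun_mult p_integral_ratfun_1)

lemma p_integral_ratfun_theta:
  assumes "p_integral_ratfun w p F"
  shows "p_integral_ratfun w p (theta i F)"
proof -
  obtain P Q u where F: "lead_exponent w Q u" "\<not> int p dvd Poly_Mapping.lookup Q u" "F = Fract P Q"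
    using assms(1) by (auto simp: p_integral_ratfun_def)
  have "theta i F = Fract (laurent_theta i P * Q - P * laurent_theta i Q) (Q * Q)"
    using F(3) lead_exponent_nonzero[OF F(1)] by (simp add: theta_Fract)
  moreover have "lead_exponent w (Q * Q) (u + u)" "\<not> int p dvd Poly_Mapping.lookup (Q * Q) (u + u)"
    using lead_exponent_mult[OF F(1) F(1)] F(2) p by (simp_all add: prime_dvd_mult_iff)
  ultimately show ?thesis
    unfolding p_integral_ratfun_def by blast
qed

lemma p_integral_ratfun_frob:
  assumes "p_integral_ratfun w p F"
  shows "p_integral_ratfun w p (ratfun_frob p F)"
proof -
  have "p > 0" using p by (rule prime_gt_0_nat)
  obtain P Q u where F: "lead_exponent w Q u" "\<not> int p dvd Poly_Mapping.lookup Q u" "F = Fract P Q"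
    using assms(1) by (auto simp: p_integral_ratfun_def)
  have "ratfun_frob p F = Fract (laurent_frob p P) (laurent_frob p Q)"
    using F(3) lead_exponent_nonzero[OF F(1)] \<open>p > 0\<close> by (simp add: ratfun_frob_Fract)
  moreover have "lead_exponent w (laurent_frob p Q) (frag_cmul (int p) u)"
    "\<not> int p dvd Poly_Mapping.lookup (laurent_frob p Q) (frag_cmul (int p) u)"
    using lead_exponent_frob[OF \<open>p > 0\<close> F(1)] F(2) \<open>p > 0\<close> by (simp_all add: lookup_laurent_frob)
  ultimately show ?thesis
    unfolding p_integral_ratfun_def by blast
qed

text \<open>A Laurent polynomial whose leading coefficient is prime to \<open>p\<close> is thus a
  unit among the integral functions.\<close>

lemma p_integral_ratfun_inverse:
  assumes "lead_exponent w P u" "\<not> int p dvd Poly_Mapping.lookup P u"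
  shows "p_integral_ratfun w p (Fract Q P)"
  using assms unfolding p_integral_ratfun_def by blast

text \<open>These are the coefficients of the power series \<open>log (1 + p g) / p\<close> in \<open>g\<close>.\<close>

lemma p_integral_ratfun_log_coeff:
  assumes "n > 0"
  shows "p_integral_ratfun w p ((- of_nat p) ^ (n - 1) / of_nat n)"
proof -
  define a where "a = multiplicity p n"
  obtain b where n: "n = p ^ a * b" and b: "\<not> p dvd b"
    unfolding a_def using assms p multiplicity_decompose'[of n p] by (auto simp: prime_nat_iff)
  have "b > 0" "p > 0"
    using b assms p by (auto simp: prime_gt_0_nat intro: gr0I)
  \<comment> \<open>The chain \<open>a < 2 ^ a \<le> p ^ a \<le> n\<close> shows that the power
    \<open>n - 1\<close> of \<open>p\<close> in the numerator absorbs the \<open>p\<close>-part of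
    \<open>n\<close>; the remaining denominator \<open>b\<close> is prime to
    \<open>p\<close>.\<close>
  have "a < 2 ^ a"
    by (rule less_exp)
  also have "2 ^ a \<le> p ^ a"
    using prime_ge_2_nat[OF p] by (rule power_mono) simp
  also have "p ^ a \<le> n"
    using \<open>b > 0\<close> by (simp add: n)
  finally have "n - 1 = a + (n - 1 - a)"
    by simp
  then have "(- of_nat p) ^ (n - 1) / of_nat n =
      (- 1) ^ (n - 1) * of_nat p ^ (n - 1 - a) * (of_nat p ^ a / of_nat n :: 'n ratfun)"
    by (metis (no_types, lifting) mult.assoc mult.commute power_add power_minus times_divide_eq_right)
  also have "of_nat p ^ a / of_nat n = (1 / of_nat b :: 'n ratfun)"
    using \<open>b > 0\<close> \<open>p > 0\<close> by (simp add: n)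
  finally have eq: "(- of_nat p) ^ (n - 1) / of_nat n =
      (- 1) ^ (n - 1) * of_nat p ^ (n - 1 - a) * (1 / of_nat b :: 'n ratfun)" .
  have "lead_exponent w (of_nat b) (0 :: 'n \<Rightarrow>\<^sub>0 int)"
    using lead_exponent_single[of "int b" w 0] \<open>b > 0\<close> by simp
  moreover have "\<not> int p dvd Poly_Mapping.lookup (of_nat b) (0 :: 'n \<Rightarrow>\<^sub>0 int)"
    using b lookup_of_nat_times[of b 1 "0 :: 'n \<Rightarrow>\<^sub>0 int"] by (simp add: lookup_one)
  ultimately have "p_integral_ratfun w p (Fract 1 (of_nat b))"
    by (rule p_integral_ratfun_inverse)
  then have "p_integral_ratfun w p (1 / of_nat b)"
    by (simp add: of_nat_fract One_fract_def)
  moreover have "p_integral_ratfun w p (- 1)"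
    using p_integral_ratfun_of_int[of "- 1"] by simp
  ultimately show ?thesis
    unfolding eq by (intro p_integral_ratfun_mult p_integral_ratfun_power p_integral_ratfun_of_nat)
qed

end

section \<open>Expansions of rational functions\<close>

text \<open>A relation given by the equation \<open>Q g = P\<close>, so that any convenient fraction
  of \<open>F\<close> can witness it. The Novikov condition makes \<open>g\<close> unique.\<close>

definition expands :: "real ^ 'n::{finite,linorder} \<Rightarrow> 'n ratfun \<Rightarrow> (('n \<Rightarrow>\<^sub>0 int) \<Rightarrow> rat) \<Rightarrow> bool" where
  "expands w F g \<longleftrightarrow> novikov w g \<and> (\<exists>P Q v. lead_exponent w Q v \<and> F = Fract P Q \<and>
     laurent_act Q g = (\<lambda>k. of_int (Poly_Mapping.lookup P k)))"

lemma expands_laurent_expansion: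
  "lead_exponent w Q v \<Longrightarrow> expands w (Fract P Q) (laurent_expansion P Q v)"
  unfolding expands_def using novikov_laurent_expansion laurent_act_laurent_expansion by blast

lemma p_integral_ratfun_expands:
  assumes "prime p" "p_integral_ratfun w p F"
  obtains g where "expands w F g" "\<And>k. p_integral p (g k)"
  using assms expands_laurent_expansion p_integral_laurent_expansion
  unfolding p_integral_ratfun_def by metis

text \<open>After cross-multiplication \<open>Q * S\<close> annihilates the Novikov series
  \<open>g - h\<close>, which is therefore zero. Hence the series of one fraction inherits the
  integrality proved from another, even if \<open>p\<close> divides the leading coefficient of its
  own denominator.\<close>

lemma expands_unique:
  assumes "expands w F g" "expands w F h"
  shows "g = h"
proof -
  obtain P Q u where F: "novikov w g" "lead_exponent w Q u" "F = Fract P Q"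
    "laurent_act Q g = (\<lambda>k. of_int (Poly_Mapping.lookup P k))"
    using assms(1) by (auto simp: expands_def)
  obtain R S v where G: "novikov w h" "lead_exponent w S v" "F = Fract R S"
    "laurent_act S h = (\<lambda>k. of_int (Poly_Mapping.lookup R k))"
    using assms(2) by (auto simp: expands_def)
  have eq: "S * P = Q * R"
    using F(3) G(3) lead_exponent_nonzero[OF F(2)] lead_exponent_nonzero[OF G(2)] by (auto simp: eq_fract mult.commute)
  have neg: "novikov w (\<lambda>k. - h k)"
    by (rule novikov_mono[OF G(1)]) simp
  have "laurent_act (Q * S) (\<lambda>k. g k + - h k) k = 0" for k
  proof -
    have "laurent_act (Q * S) g k = of_int (Poly_Mapping.lookup (S * P) k)"
      by (simp only: mult.commute[of Q S] laurent_act_mult F(4) laurent_act_poly)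
    moreover have "laurent_act (Q * S) h k = of_int (Poly_Mapping.lookup (Q * R) k)"
      by (simp only: laurent_act_mult G(4) laurent_act_poly)
    ultimately show ?thesis
      by (simp add: laurent_act_add_right laurent_act_minus_right eq del: add_uminus_conv_diff)
  qed
  then have "g k + - h k = 0" for k
    using laurent_act_eq_0[OF lead_exponent_mult(1)[OF F(2) G(2)] novikov_add[OF F(1) neg]] by blast
  then show ?thesis
    by (auto simp: fun_eq_iff)
qed

lemma expands_add:
  assumes "expands w F g" "expands w G h"
  shows "expands w (F + G) (\<lambda>k. g k + h k)"
proof -
  obtain P Q u where F: "novikov w g" "lead_exponent w Q u" "F = Fract P Q"
    "laurent_act Q g = (\<lambda>k. of_int (Poly_Mapping.lookup P k))"
    using assms(1) by (auto simp: expands_def)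
  obtain R S v where G: "novikov w h" "lead_exponent w S v" "G = Fract R S"
    "laurent_act S h = (\<lambda>k. of_int (Poly_Mapping.lookup R k))"
    using assms(2) by (auto simp: expands_def)
  have "laurent_act (Q * S) (\<lambda>k. g k + h k) k = of_int (Poly_Mapping.lookup (P * S + R * Q) k)" for k
  proof -
    have "laurent_act (Q * S) g k = of_int (Poly_Mapping.lookup (S * P) k)"
      by (simp only: mult.commute[of Q S] laurent_act_mult F(4) laurent_act_poly)
    moreover have "laurent_act (Q * S) h k = of_int (Poly_Mapping.lookup (Q * R) k)"
      by (simp only: laurent_act_mult G(4) laurent_act_poly)
    ultimately show ?thesis
      by (simp add: laurent_act_add_right lookup_add mult.commute)
  qed
  moreover have "F + G = Fract (P * S + R * Q) (Q * S)"
    using F(3) G(3) lead_exponent_nonzero[OF F(2)] lead_exponent_nonzero[OF G(2)] by simp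
  ultimately show ?thesis
    unfolding expands_def using novikov_add[OF F(1) G(1)] lead_exponent_mult(1)[OF F(2) G(2)] by blast
qed

lemma expands_laurent_mult:
  assumes "expands w F g"
  shows "expands w (Fract P 1 * F) (laurent_act P g)"
proof -
  obtain R Q u where F: "novikov w g" "lead_exponent w Q u" "F = Fract R Q"
    "laurent_act Q g = (\<lambda>k. of_int (Poly_Mapping.lookup R k))"
    using assms(1) by (auto simp: expands_def)
  have "novikov w (laurent_act P g)"
    unfolding laurent_act_def
  proof (rule novikov_sum)
    fix l
    show "novikov w (\<lambda>k. of_int (Poly_Mapping.lookup P l) * g (k - l))"
      by (rule novikov_mono[OF novikov_shift[OF F(1), of l]]) (metis mult_zero_right)
  qed
  moreover have "laurent_act Q (laurent_act P g) = (\<lambda>k. of_int (Poly_Mapping.lookup (P * R) k))"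
  proof -
    have "laurent_act Q (laurent_act P g) = laurent_act P (laurent_act Q g)"
      by (simp only: laurent_act_mult[symmetric] mult.commute)
    also have "\<dots> = (\<lambda>k. of_int (Poly_Mapping.lookup (P * R) k))"
      unfolding F(4) by (rule ext) (rule laurent_act_poly)
    finally show ?thesis .
  qed
  moreover have "Fract P 1 * F = Fract (P * R) Q"
    by (simp add: F(3))
  ultimately show ?thesis
    unfolding expands_def using F(2) by blast
qed

lemma expands_of_int_mult:
  assumes "expands w F g"
  shows "expands w (of_int n * F) (\<lambda>k. of_int n * g k)"
proof -
  have "of_int n = Fract (Poly_Mapping.single 0 n) 1"
    by (cases n) (auto simp: of_nat_fract One_fract_def single_uminus simp del: of_nat_Suc)
  moreover have "laurent_act (Poly_Mapping.single 0 n) g = (\<lambda>k. of_int n * g k)"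
    by (rule ext) (simp only: laurent_act_single diff_zero)
  ultimately show ?thesis
    using expands_laurent_mult[OF assms, of "Poly_Mapping.single 0 n"] by metis
qed

lemma expands_diff:
  assumes "expands w F g" "expands w G h"
  shows "expands w (F - G) (\<lambda>k. g k - h k)"
  using expands_add[OF assms(1) expands_of_int_mult[OF assms(2), of "- 1"]] by simp

text \<open>This is the Leibniz rule for the product of \<open>Q\<close> and \<open>g\<close>,
  solved for the term in which \<open>g\<close> is differentiated; it comes from splitting the
  exponent \<open>k\<close> as \<open>l + (k - l)\<close>.\<close>

lemma laurent_act_theta_right:
  "laurent_act Q (\<lambda>k. of_int (Poly_Mapping.lookup k i) * g k) k =
     of_int (Poly_Mapping.lookup k i) * laurent_act Q g k - laurent_act (laurent_theta i Q) g k"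
  unfolding laurent_act_superset[OF finite_keys keys_laurent_theta]
  by (simp add: laurent_act_def lookup_laurent_theta sum_distrib_left lookup_minus algebra_simps
      flip: sum_subtractf)

lemma expands_theta:
  assumes "expands w F g"
  shows "expands w (theta i F) (\<lambda>k. of_int (Poly_Mapping.lookup k i) * g k)"
proof -
  obtain P Q u where F: "novikov w g" "lead_exponent w Q u" "F = Fract P Q"
    "laurent_act Q g = (\<lambda>k. of_int (Poly_Mapping.lookup P k))"
    using assms(1) by (auto simp: expands_def)
  have "laurent_act (Q * Q) (\<lambda>k. of_int (Poly_Mapping.lookup k i) * g k) k =
      of_int (Poly_Mapping.lookup (laurent_theta i P * Q - P * laurent_theta i Q) k)" for k
  proof -
    have "laurent_act Q (\<lambda>k. of_int (Poly_Mapping.lookup k i) * g k) =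
        (\<lambda>k. of_int (Poly_Mapping.lookup (laurent_theta i P) k) + - laurent_act (laurent_theta i Q) g k)"
      by (rule ext) (simp add: laurent_act_theta_right F(4) lookup_laurent_theta)
    then have "laurent_act (Q * Q) (\<lambda>k. of_int (Poly_Mapping.lookup k i) * g k) k =
        laurent_act Q (\<lambda>k. of_int (Poly_Mapping.lookup (laurent_theta i P) k)) k
        - laurent_act Q (laurent_act (laurent_theta i Q) g) k"
      by (simp only: laurent_act_mult laurent_act_add_right laurent_act_minus_right diff_conv_add_uminus)
    also have "laurent_act Q (laurent_act (laurent_theta i Q) g) = laurent_act (laurent_theta i Q) (laurent_act Q g)"
      by (simp only: laurent_act_mult[symmetric] mult.commute)
    finally show ?thesis
      by (simp add: F(4) laurent_act_poly lookup_minus mult.commute)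
  qed
  moreover have "novikov w (\<lambda>k. of_int (Poly_Mapping.lookup k i) * g k)"
    by (rule novikov_mono[OF F(1)]) simp
  moreover have "theta i F = Fract (laurent_theta i P * Q - P * laurent_theta i Q) (Q * Q)"
    using F(3) lead_exponent_nonzero[OF F(2)] by (simp add: theta_Fract)
  ultimately show ?thesis
    unfolding expands_def using lead_exponent_mult(1)[OF F(2) F(2)] by blast
qed

section \<open>The Frobenius lift on series\<close>

definition series_frob :: "nat \<Rightarrow> (('n \<Rightarrow>\<^sub>0 int) \<Rightarrow> rat) \<Rightarrow> ('n \<Rightarrow>\<^sub>0 int) \<Rightarrow> rat" where
  "series_frob p g k =
     (if k \<in> range (frag_cmul (int p)) then g (inv_into UNIV (frag_cmul (int p)) k) else 0)"

lemma series_frob_frag_cmul [simp]: "p > 0 \<Longrightarrow> series_frob p g (frag_cmul (int p) k) = g k"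
  by (simp add: series_frob_def inv_into_f_f[OF inj_frag_cmul])

lemma series_frob_outside: "k \<notin> range (frag_cmul (int p)) \<Longrightarrow> series_frob p g k = 0"
  by (simp add: series_frob_def)

lemma series_frob_eqI:
  assumes "p > 0" "\<And>k. h (frag_cmul (int p) k) = g k" "\<And>k. k \<notin> range (frag_cmul (int p)) \<Longrightarrow> h k = 0"
  shows "h = series_frob p g"
proof
  fix k show "h k = series_frob p g k"
    using assms by (cases "k \<in> range (frag_cmul (int p))") (auto simp: series_frob_outside)
qed

lemma laurent_act_frob:
  fixes Q :: "('n, int) laurent"
  assumes "p > 0"
  shows "laurent_act (laurent_frob p Q) (series_frob p g) = series_frob p (laurent_act Q g)"
proof (rule series_frob_eqI[OF assms])
  have inj: "inj_on (frag_cmul (int p)) A" for A :: "('n \<Rightarrow>\<^sub>0 int) set"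
    using inj_frag_cmul[of "int p"] assms by (metis inj_on_subset of_nat_0_less_iff less_irrefl subset_UNIV)
  have act: "laurent_act (laurent_frob p Q) (series_frob p g) k =
      (\<Sum>l\<in>Poly_Mapping.keys Q. of_int (Poly_Mapping.lookup Q l) * series_frob p g (k - frag_cmul (int p) l))" for k
    unfolding laurent_act_def keys_laurent_frob[OF assms] sum.reindex[OF inj] o_def lookup_laurent_frob[OF assms] ..
  fix k :: "'n \<Rightarrow>\<^sub>0 int"
  have "frag_cmul (int p) k - frag_cmul (int p) l = frag_cmul (int p) (k - l)" for l
    by (rule poly_mapping_eqI) (simp only: lookup_minus lookup_frag_cmul right_diff_distrib)
  then show "laurent_act (laurent_frob p Q) (series_frob p g) (frag_cmul (int p) k) = laurent_act Q g k"
    unfolding act by (simp only: series_frob_frag_cmul[OF assms] laurent_act_def)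
next
  fix k :: "'n \<Rightarrow>\<^sub>0 int" assume k: "k \<notin> range (frag_cmul (int p))"
  have "series_frob p g (k - l) = 0" if "l \<in> Poly_Mapping.keys (laurent_frob p Q)" for l
  proof (rule series_frob_outside)
    obtain l' where l: "l = frag_cmul (int p) l'"
      using \<open>l \<in> _\<close> by (auto simp: keys_laurent_frob[OF assms])
    show "k - l \<notin> range (frag_cmul (int p))"
    proof
      assume "k - l \<in> range (frag_cmul (int p))"
      then obtain t where "k - l = frag_cmul (int p) t"
        by blast
      then have "k = frag_cmul (int p) t + l"
        by (metis diff_add_cancel)
      then have "k = frag_cmul (int p) (t + l')"
        unfolding l by (simp only: frag_cmul_distrib2)
      with k show False by blast
    qed
  qed
  then show "laurent_act (laurent_frob p Q) (series_frob p g) k = 0"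
    unfolding laurent_act_def by (intro sum.neutral ballI) (simp only: mult_zero_right)
qed

lemma novikov_series_frob:
  assumes "p > 0" "novikov w g"
  shows "novikov w (series_frob p g)"
  unfolding novikov_def
proof
  fix C
  have "{k. series_frob p g k \<noteq> 0 \<and> weight w k \<le> C} \<subseteq>
      frag_cmul (int p) ` {k. g k \<noteq> 0 \<and> weight w k \<le> C / real p}"
  proof
    fix k assume k: "k \<in> {k. series_frob p g k \<noteq> 0 \<and> weight w k \<le> C}"
    then have "k \<in> range (frag_cmul (int p))"
      using series_frob_outside[of k p g] by auto
    then obtain l where "k = frag_cmul (int p) l"
      by blast
    then show "k \<in> frag_cmul (int p) ` {k. g k \<noteq> 0 \<and> weight w k \<le> C / real p}"
      using k assms(1) by (auto simp: field_simps)
  qed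
  then show "finite {k. series_frob p g k \<noteq> 0 \<and> weight w k \<le> C}"
    by (rule finite_subset) (use assms(2) in \<open>simp add: novikov_def\<close>)
qed

lemma expands_frob:
  assumes "p > 0" "expands w F g"
  shows "expands w (ratfun_frob p F) (series_frob p g)"
proof -
  obtain P Q u where F: "novikov w g" "lead_exponent w Q u" "F = Fract P Q"
    "laurent_act Q g = (\<lambda>k. of_int (Poly_Mapping.lookup P k))"
    using assms(2) by (auto simp: expands_def)
  have "(\<lambda>k. of_int (Poly_Mapping.lookup (laurent_frob p P) k)) =
      series_frob p (\<lambda>k. of_int (Poly_Mapping.lookup P k))"
  proof (rule series_frob_eqI[OF assms(1)])
    fix k :: "'a \<Rightarrow>\<^sub>0 int" assume "k \<notin> range (frag_cmul (int p))"
    then have "k \<notin> Poly_Mapping.keys (laurent_frob p P)"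
      by (auto simp: keys_laurent_frob[OF assms(1)])
    then show "rat_of_int (Poly_Mapping.lookup (laurent_frob p P) k) = 0"
      by (simp add: in_keys_iff)
  qed (simp add: lookup_laurent_frob[OF assms(1)])
  then have "laurent_act (laurent_frob p Q) (series_frob p g) =
      (\<lambda>k. of_int (Poly_Mapping.lookup (laurent_frob p P) k))"
    by (simp only: laurent_act_frob[OF assms(1)] F(4))
  moreover have "ratfun_frob p F = Fract (laurent_frob p P) (laurent_frob p Q)"
    using F(3) lead_exponent_nonzero[OF F(2)] assms(1) by (simp add: ratfun_frob_Fract)
  ultimately show ?thesis
    unfolding expands_def using novikov_series_frob[OF assms(1) F(1)] lead_exponent_frob[OF assms(1) F(2)]
    by blast
qed

section \<open>The Frobenius lift on logarithmic derivatives\<close>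

text \<open>The inner binomial coefficients of a prime exponent are divisible by that prime.\<close>

lemma prime_power_add:
  fixes a b :: "'a::comm_ring_1"
  assumes "prime p"
  shows "\<exists>c. (a + b) ^ p = a ^ p + b ^ p + of_nat p * c"
proof -
  have p: "p > 0" using assms by (rule prime_gt_0_nat)
  have "of_nat (p choose k) * a ^ k * b ^ (p - k) =
      of_nat p * (of_nat ((p choose k) div p) * a ^ k * b ^ (p - k))" if "k \<in> {1..<p}" for k
  proof -
    have "p dvd (p choose k)"
      using that assms by (intro dvd_choose_prime) auto
    then have "(of_nat (p choose k) :: 'a) = of_nat p * of_nat ((p choose k) div p)"
      by (simp flip: of_nat_mult)
    then show ?thesis by (simp add: mult.assoc)
  qed
  then have mid: "(\<Sum>k\<in>{1..<p}. of_nat (p choose k) * a ^ k * b ^ (p - k)) =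
      of_nat p * (\<Sum>k\<in>{1..<p}. of_nat ((p choose k) div p) * a ^ k * b ^ (p - k))"
    by (simp add: sum_distrib_left)
  have "{..p} = insert 0 (insert p {1..<p})"
    using p by auto
  then have "(a + b) ^ p = b ^ p + (a ^ p + (\<Sum>k\<in>{1..<p}. of_nat (p choose k) * a ^ k * b ^ (p - k)))"
    using p by (simp add: binomial_ring)
  then show ?thesis
    unfolding mid by (intro exI[of _ "\<Sum>k\<in>{1..<p}. of_nat ((p choose k) div p) * a ^ k * b ^ (p - k)"])
      (simp add: algebra_simps)
qed

lemma prime_int_power:
  fixes a :: int
  assumes "prime p"
  shows "\<exists>c. a ^ p = a + int p * c"
proof (induction a rule: int_induct[of _ 0])
  case base
  then show ?case using prime_gt_0_nat[OF assms] by (intro exI[of _ 0]) simp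
next
  case (step1 a)
  then obtain c where "a ^ p = a + int p * c" by blast
  moreover obtain d where "(a + 1) ^ p = a ^ p + 1 ^ p + of_nat p * d"
    using prime_power_add[OF assms] by blast
  ultimately show ?case by (intro exI[of _ "c + d"]) (simp add: algebra_simps)
next
  case (step2 a)
  then obtain c where "a ^ p = a + int p * c" by blast
  moreover obtain d where "(a - 1 + 1) ^ p = (a - 1) ^ p + 1 ^ p + of_nat p * d"
    using prime_power_add[OF assms] by blast
  ultimately show ?case by (intro exI[of _ "c - d"]) (simp add: algebra_simps)
qed

lemma single_power:
  "Poly_Mapping.single k c ^ n = Poly_Mapping.single (frag_cmul (int n) k) (c ^ n)"
  for c :: "'c::comm_ring_1"
proof (induction n)
  case (Suc n)
  have "frag_cmul (int (Suc n)) k = k + frag_cmul (int n) k"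
    by (rule poly_mapping_eqI) (simp add: lookup_add algebra_simps)
  with Suc show ?case
    by (simp add: mult_single)
qed simp

text \<open>Modulo \<open>p\<close>, the \<open>p\<close>-th power is additive over the monomials of
  \<open>P\<close> and, by Fermat, fixes their integer coefficients, so all it does is multiply the
  exponents by \<open>p\<close>.\<close>

lemma laurent_frob_cong:
  fixes P :: "('n::{finite,linorder}, int) laurent"
  assumes "prime p"
  shows "\<exists>G. laurent_frob p P = P ^ p + of_nat p * G"
proof -
  have "\<exists>G. laurent_frob p (\<Sum>k\<in>A. Poly_Mapping.single k (Poly_Mapping.lookup P k)) =
      (\<Sum>k\<in>A. Poly_Mapping.single k (Poly_Mapping.lookup P k)) ^ p + of_nat p * G" if "finite A" for A
    using that
  proof (induction A rule: finite_induct)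
    case empty
    then show ?case using prime_gt_0_nat[OF assms] by (intro exI[of _ 0]) simp
  next
    case (insert k A)
    let ?c = "Poly_Mapping.lookup P k"
    let ?T = "\<Sum>k\<in>A. Poly_Mapping.single k (Poly_Mapping.lookup P k)"
    obtain d where d: "?c ^ p = ?c + int p * d"
      using prime_int_power[OF assms] by blast
    obtain G where G: "laurent_frob p ?T = ?T ^ p + of_nat p * G"
      using insert by blast
    obtain H where H: "(Poly_Mapping.single k ?c + ?T) ^ p =
        Poly_Mapping.single k ?c ^ p + ?T ^ p + of_nat p * H"
      using prime_power_add[OF assms] by blast
    let ?D = "Poly_Mapping.single (frag_cmul (int p) k) d"
    have "Poly_Mapping.single k ?c ^ p = Poly_Mapping.single (frag_cmul (int p) k) ?c + of_nat p * ?D"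
      unfolding single_power d single_add
      by (rule arg_cong[of _ _ "(+) _"], rule poly_mapping_eqI)
         (simp add: lookup_of_nat_times lookup_single when_def)
    then have "laurent_frob p (Poly_Mapping.single k ?c + ?T) =
        (Poly_Mapping.single k ?c + ?T) ^ p + of_nat p * (G - H - ?D)"
      unfolding laurent_frob_add laurent_frob_single G H by (simp add: algebra_simps)
    then show ?case
      using insert by auto
  qed
  from this[of "Poly_Mapping.keys P"] show ?thesis
    by (simp only: laurent_sum_singles[symmetric] finite_keys simp_thms)
qed

text \<open>Up to \<open>p ^ N\<close>, the \<open>p\<close>-integral function \<open>u\<close> is \<open>log (P(x ^ p) / P ^ p) / p\<close>.\<close>

lemma dlog_frob_laurent:
  fixes P :: "('n::{finite,linorder}, int) laurent"
  assumes p: "prime p" and P: "lead_exponent w P v" "\<not> int p dvd Poly_Mapping.lookup P v"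
  obtains u where "p_integral_ratfun w p u"
    "\<And>i. \<exists>e. p_integral_ratfun w p e \<and>
       ratfun_frob p (theta i (Fract P 1) / Fract P 1) =
         theta i (Fract P 1) / Fract P 1 + theta i u + of_nat p ^ N * e"
proof -
  have p0: "p > 0" using p by (rule prime_gt_0_nat)
  obtain G where G: "laurent_frob p P = P ^ p + of_nat p * G"
    using laurent_frob_cong[OF p] by blast
  note closed = p_integral_ratfun_mult[OF p] p_integral_ratfun_laurent[OF p] p_integral_ratfun_power[OF p]
    p_integral_ratfun_theta[OF p] p_integral_ratfun_sum[OF p]
  have "P \<noteq> 0" using lead_exponent_nonzero P(1) by blast
  define F where "F = Fract P 1"
  define \<Phi> where "\<Phi> = ratfun_frob p F"
  \<comment> \<open>Chosen so that the congruence for \<open>laurent_frob p P\<close>, divided by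
    \<open>P ^ p\<close>, reads \<open>\<Phi> / F ^ p = 1 + of_nat p * g\<close>.\<close>
  define g where "g = Fract G 1 * (Fract 1 P) ^ p"
  have F0: "F \<noteq> 0" and \<Phi>0: "\<Phi> \<noteq> 0" and \<Phi>: "\<Phi> = Fract (laurent_frob p P) 1" and inv: "Fract 1 P = 1 / F"
    using \<open>P \<noteq> 0\<close> p0
    by (simp_all add: F_def \<Phi>_def Zero_fract_def One_fract_def eq_fract ratfun_frob_Fract)
  have g_int: "p_integral_ratfun w p g"
    unfolding g_def using p_integral_ratfun_inverse[OF p P] by (intro closed)
  have Fract_power: "Fract (P ^ n) 1 = F ^ n" for n
  proof (induction n)
    case (Suc n)
    have "Fract (P ^ Suc n) 1 = Fract P 1 * Fract (P ^ n) 1"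
      by simp
    then show ?case by (simp only: Suc F_def power_Suc)
  qed (simp add: One_fract_def)
  have "\<Phi> = Fract (P ^ p) 1 + of_nat p * Fract G 1"
    unfolding \<Phi> G of_nat_fract by simp
  then have \<Phi>_eq: "\<Phi> = F ^ p * (1 + of_nat p * g)"
    using F0 by (simp add: g_def inv Fract_power field_simps)
  have h0: "1 + of_nat p * g \<noteq> 0"
    using \<Phi>_eq \<Phi>0 by auto
  \<comment> \<open>The inverse of \<open>1 + of_nat p * g\<close> is integral: it has denominator
    \<open>laurent_frob p P\<close>, whose leading coefficient is that of \<open>P\<close>.\<close>
  have "lead_exponent w (laurent_frob p P) (frag_cmul (int p) v)"
    "\<not> int p dvd Poly_Mapping.lookup (laurent_frob p P) (frag_cmul (int p) v)"
    using lead_exponent_frob[OF p0 P(1)] P(2) p0 by (simp_all add: lookup_laurent_frob)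
  then have "p_integral_ratfun w p (Fract (P ^ p) (laurent_frob p P))"
    by (rule p_integral_ratfun_inverse[OF p])
  also have "Fract (P ^ p) (laurent_frob p P) = F ^ p / \<Phi>"
    by (simp add: \<Phi> flip: Fract_power)
  also have "F ^ p / \<Phi> = 1 / (1 + of_nat p * g)"
    using F0 h0 by (simp add: \<Phi>_eq)
  finally have h_int: "p_integral_ratfun w p (1 / (1 + of_nat p * g))" .
  have dlog: "ratfun_frob p (theta i F / F) = theta i F / F + theta i g / (1 + of_nat p * g)" for i
  proof -
    have "of_nat p * ratfun_frob p (theta i F / F) = theta i \<Phi> / \<Phi>"
      using F0 p0 by (simp add: ratfun_frob_divide \<Phi>_def theta_frob)
    also have "theta i \<Phi> = of_nat p * F ^ (p - 1) * theta i F * (1 + of_nat p * g)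
        + F ^ p * (of_nat p * theta i g)"
      by (simp add: \<Phi>_eq theta_mult theta_power theta_add)
    also have "F ^ p = F * F ^ (p - 1)"
      using p0 by (simp add: power_eq_if)
    also have "(of_nat p * F ^ (p - 1) * theta i F * (1 + of_nat p * g)
        + F * F ^ (p - 1) * (of_nat p * theta i g)) / \<Phi> =
        of_nat p * (theta i F / F + theta i g / (1 + of_nat p * g))"
    proof -
      have "F ^ p = F * F ^ (p - 1)"
        using p0 by (simp add: power_eq_if)
      then have "\<Phi> = F * F ^ (p - 1) * (1 + of_nat p * g)"
        by (simp add: \<Phi>_eq)
      then show ?thesis
        using F0 h0 by (simp add: divide_simps) (simp add: algebra_simps)
    qed
    finally show ?thesis
      using p0 by simp
  qed
  define c :: "nat \<Rightarrow> 'n ratfun" where "c n = (- of_nat p) ^ (n - 1) / of_nat n" for n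
  define u where "u = (\<Sum>n=1..N. c n * g ^ n)"
  have "p_integral_ratfun w p u"
    unfolding u_def c_def by (intro closed p_integral_ratfun_log_coeff[OF p] g_int) auto
  moreover have "\<exists>e. p_integral_ratfun w p e \<and>
      ratfun_frob p (theta i F / F) = theta i F / F + theta i u + of_nat p ^ N * e" for i
  proof (intro exI conjI)
    \<comment> \<open>The tail of the geometric series for
      \<open>theta i g / (1 + of_nat p * g)\<close> that the truncated logarithm misses, with its
      factor \<open>p ^ N\<close> removed.\<close>
    let ?e = "of_int ((- 1) ^ N) * g ^ N * theta i g * (1 / (1 + of_nat p * g))"
    show "p_integral_ratfun w p ?e"
      using p_integral_ratfun_of_int[OF p] g_int h_int by (intro closed)
    have theta_c: "theta i (c n) = 0" for n
    proof (cases "n = 0")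
      case False
      \<comment> \<open>An integer multiple of \<open>c n\<close> is an integer, so the derivations
        kill \<open>c n\<close>.\<close>
      have "of_nat n * c n = of_int ((- int p) ^ (n - 1))"
        using False by (simp add: c_def)
      then have "theta i (of_nat n * c n) = 0"
        by (simp only: theta_of_int)
      then show ?thesis
        using False by (simp add: theta_mult)
    qed (simp add: c_def)
    have "theta i u = (\<Sum>n=1..N. (- (of_nat p * g)) ^ (n - 1) * theta i g)"
      unfolding u_def theta_sum
    proof (rule sum.cong[OF refl])
      fix n assume n: "n \<in> {1..N}"
      have "theta i (c n * g ^ n) = c n * of_nat n * g ^ (n - 1) * theta i g"
        by (simp only: theta_mult theta_c theta_power mult_zero_left add_0 mult.assoc)
      also have "c n * of_nat n = (- of_nat p) ^ (n - 1)"
        using n by (simp add: c_def)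
      finally have "theta i (c n * g ^ n) = (- of_nat p) ^ (n - 1) * g ^ (n - 1) * theta i g" .
      then show "theta i (c n * g ^ n) = (- (of_nat p * g)) ^ (n - 1) * theta i g"
        by (simp flip: power_mult_distrib)
    qed
    also have "\<dots> = (\<Sum>n<N. (- (of_nat p * g)) ^ n) * theta i g"
      unfolding sum_distrib_right
      by (rule sum.reindex_bij_witness[of _ "\<lambda>n. n + 1" "\<lambda>n. n - 1"]) auto
    finally have "(1 + of_nat p * g) * theta i u = (1 - (- (of_nat p * g)) ^ N) * theta i g"
      using one_diff_power_eq[of "- (of_nat p * g)" N] by simp
    moreover have "(- (of_nat p * g)) ^ N = of_nat p ^ N * (of_int ((- 1) ^ N) * g ^ N)"
      by (simp add: power_minus[of "of_nat p * g"] power_mult_distrib)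
    ultimately have "theta i g / (1 + of_nat p * g) = theta i u + of_nat p ^ N * ?e"
      using h0 by (simp add: field_simps)
    then show "ratfun_frob p (theta i F / F) = theta i F / F + theta i u + of_nat p ^ N * ?e"
      unfolding dlog by simp
  qed
  ultimately show thesis
    unfolding F_def by (rule that)
qed

text \<open>Logarithmic derivatives turn quotients into differences, so the correction
  \<open>u\<close> for a fraction is the difference of those for numerator and denominator.\<close>

lemma dlog_frob:
  fixes P Q :: "('n::{finite,linorder}, int) laurent"
  assumes p: "prime p"
    and P: "lead_exponent w P v" "\<not> int p dvd Poly_Mapping.lookup P v"
    and Q: "lead_exponent w Q v'" "\<not> int p dvd Poly_Mapping.lookup Q v'"
    and F: "F = Fract P Q"
  obtains u where "p_integral_ratfun w p u"
    "\<And>i. \<exists>e. p_integral_ratfun w p e \<and>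
       ratfun_frob p (theta i F / F) = theta i F / F + theta i u + of_nat p ^ N * e"
proof -
  have p0: "p > 0" using p by (rule prime_gt_0_nat)
  define A B where "A = Fract P 1" and "B = Fract Q 1"
  have AB: "A \<noteq> 0" "B \<noteq> 0" "F = A / B"
    using lead_exponent_nonzero[OF P(1)] lead_exponent_nonzero[OF Q(1)]
    by (auto simp: A_def B_def Zero_fract_def eq_fract F)
  have dlog: "theta i F / F = theta i A / A - theta i B / B" for i
    unfolding AB(3) using AB(1,2) by (simp add: theta_divide divide_simps)
  obtain a where a: "p_integral_ratfun w p a"
    "\<And>i. \<exists>e. p_integral_ratfun w p e \<and>
       ratfun_frob p (theta i A / A) = theta i A / A + theta i a + of_nat p ^ N * e"
    using dlog_frob_laurent[OF p P] unfolding A_def by metis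
  obtain b where b: "p_integral_ratfun w p b"
    "\<And>i. \<exists>e. p_integral_ratfun w p e \<and>
       ratfun_frob p (theta i B / B) = theta i B / B + theta i b + of_nat p ^ N * e"
    using dlog_frob_laurent[OF p Q] unfolding B_def by metis
  show thesis
  proof (rule that[of "a - b"])
    show "p_integral_ratfun w p (a - b)"
      using a(1) b(1) by (rule p_integral_ratfun_diff[OF p])
    fix i
    obtain d e where "p_integral_ratfun w p d" "p_integral_ratfun w p e"
      "ratfun_frob p (theta i A / A) = theta i A / A + theta i a + of_nat p ^ N * d"
      "ratfun_frob p (theta i B / B) = theta i B / B + theta i b + of_nat p ^ N * e"
      using a(2) b(2) by metis
    then show "\<exists>e. p_integral_ratfun w p e \<and>
        ratfun_frob p (theta i F / F) = theta i F / F + theta i (a - b) + of_nat p ^ N * e"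
      unfolding dlog using p_integral_ratfun_diff[OF p] p0
      by (intro exI[of _ "d - e"]) (simp add: ratfun_frob_diff theta_diff algebra_simps)
  qed
qed

text \<open>Division by \<open>F\<close> turns its numerator into a denominator, hence the condition
  on the leading coefficient of \<open>P\<close> besides that of \<open>Q\<close>.\<close>

lemma p_integral_dlog:
  fixes P Q :: "('n::{finite,linorder}, int) laurent"
  assumes p: "prime p"
    and P: "lead_exponent w P v" "\<not> int p dvd Poly_Mapping.lookup P v"
    and Q: "lead_exponent w Q v'" "\<not> int p dvd Poly_Mapping.lookup Q v'"
    and F: "F = Fract P Q"
  shows "p_integral_ratfun w p (theta i F / F)"
proof -
  have "theta i F / F = theta i F * Fract Q P"
    by (simp add: F divide_inverse)
  then show ?thesis
    using p_integral_ratfun_inverse[OF p P, of Q] p_integral_ratfun_inverse[OF p Q, of P]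
    by (auto simp: F intro: p_integral_ratfun_mult[OF p] p_integral_ratfun_theta[OF p])
qed

text \<open>Both sides are the mixed second derivative of \<open>log F\<close>.\<close>

lemma theta_dlog_symmetric:
  assumes "F \<noteq> 0"
  shows "theta i (theta j F / F) = theta j (theta i F / F)"
  using assms by (simp add: theta_divide theta_commute[of i j] mult.commute)

section \<open>Coefficients divisible by prime powers\<close>

text \<open>Divisibility is demanded only on the multiples of \<open>p ^ r\<close> in the exponent
  lattice. This admits Euler derivatives of integral functions besides \<open>p ^ r\<close> times an
  integral function.\<close>

definition coeffs_divisible :: "real ^ 'n::{finite,linorder} \<Rightarrow> nat \<Rightarrow> nat \<Rightarrow> 'n ratfun \<Rightarrow> bool" where
  "coeffs_divisible w p r F \<longleftrightarrow> (\<exists>g. expands w F g \<and>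
     (\<forall>k. p_cong p r (g (frag_cmul (int (p ^ r)) k)) 0))"

context
  fixes w :: "real ^ 'n::{finite,linorder}" and p :: nat
  assumes p: "prime p"
begin

lemma coeffs_divisible_add:
  assumes "coeffs_divisible w p r F" "coeffs_divisible w p r G"
  shows "coeffs_divisible w p r (F + G)"
proof -
  obtain g where g: "expands w F g" "\<And>k. p_cong p r (g (frag_cmul (int (p ^ r)) k)) 0"
    using assms(1) unfolding coeffs_divisible_def by blast
  obtain h where h: "expands w G h" "\<And>k. p_cong p r (h (frag_cmul (int (p ^ r)) k)) 0"
    using assms(2) unfolding coeffs_divisible_def by blast
  have "p_cong p r (g (frag_cmul (int (p ^ r)) k) + h (frag_cmul (int (p ^ r)) k)) 0" for k
  proof -
    obtain c d where "p_integral p c" "p_integral p d"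
      "g (frag_cmul (int (p ^ r)) k) = of_nat (p ^ r) * c" "h (frag_cmul (int (p ^ r)) k) = of_nat (p ^ r) * d"
      using g(2)[of k] h(2)[of k] unfolding p_cong_def diff_zero by blast
    then show ?thesis
      unfolding p_cong_def using p_integral_add[OF p, of c d]
      by (intro exI[of _ "c + d"]) (simp add: distrib_left)
  qed
  then show ?thesis
    unfolding coeffs_divisible_def using expands_add[OF g(1) h(1)] by blast
qed

lemma coeffs_divisible_mult:
  assumes "p_integral_ratfun w p F"
  shows "coeffs_divisible w p r (of_nat p ^ r * F)"
proof -
  obtain g where g: "expands w F g" "\<And>k. p_integral p (g k)"
    using p_integral_ratfun_expands[OF p assms] by blast
  have "expands w (of_nat p ^ r * F) (\<lambda>k. of_nat (p ^ r) * g k)"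
    using expands_of_int_mult[OF g(1), of "int (p ^ r)"] by simp
  moreover have "p_cong p r (of_nat (p ^ r) * g k) 0" for k
    unfolding p_cong_def using g(2) by (intro exI[of _ "g k"]) simp
  ultimately show ?thesis
    unfolding coeffs_divisible_def by blast
qed

lemma coeffs_divisible_0: "coeffs_divisible w p r 0"
  using coeffs_divisible_mult[OF p_integral_ratfun_0[OF p]] by simp

lemma coeffs_divisible_sum:
  "(\<And>a. a \<in> A \<Longrightarrow> coeffs_divisible w p r (F a)) \<Longrightarrow> coeffs_divisible w p r (sum F A)"
proof (induction A rule: infinite_finite_induct)
qed (simp_all add: coeffs_divisible_add coeffs_divisible_0)

text \<open>The Euler derivation scales a coefficient by a component of its exponent, here a
  multiple of \<open>p ^ r\<close>.\<close>

lemma coeffs_divisible_theta: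
  assumes "p_integral_ratfun w p F"
  shows "coeffs_divisible w p r (theta i F)"
proof -
  obtain g where g: "expands w F g" "\<And>k. p_integral p (g k)"
    using p_integral_ratfun_expands[OF p assms] by blast
  have "p_cong p r (of_int (Poly_Mapping.lookup (frag_cmul (int (p ^ r)) k) i) * g (frag_cmul (int (p ^ r)) k)) 0" for k
    unfolding p_cong_def using p_integral_mult[OF p p_integral_of_int[OF p] g(2)]
    by (intro exI[of _ "of_int (Poly_Mapping.lookup k i) * g (frag_cmul (int (p ^ r)) k)"]) simp
  then show ?thesis
    unfolding coeffs_divisible_def using expands_theta[OF g(1)] by blast
qed

end

section \<open>Determinants of closed columns\<close>

text \<open>The Leibniz formula with column \<open>t\<close> passed separately as \<open>c\<close>,
  so that this column can be varied linearly while the others stay.\<close>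

definition column_det :: "nat \<Rightarrow> nat \<Rightarrow> (nat \<Rightarrow> nat \<Rightarrow> 'a) \<Rightarrow> (nat \<Rightarrow> 'a) \<Rightarrow> 'a::comm_ring_1" where
  "column_det m t M c = (\<Sum>\<pi> | \<pi> permutes {0..<m}.
     of_int (sign \<pi>) * (c (\<pi> t) * (\<Prod>j\<in>{0..<m} - {t}. M (\<pi> j) j)))"

lemma det_eq_column_det:
  assumes "t < m"
  shows "Determinant.det (Matrix.mat m m (\<lambda>(i, j). M i j)) = column_det m t M (\<lambda>i. M i t)"
proof -
  have "Determinant.det (Matrix.mat m m (\<lambda>(i, j). M i j)) = (\<Sum>\<pi> | \<pi> permutes {0..<m}.
     of_int (sign \<pi>) * (\<Prod>j<m. Matrix.mat m m (\<lambda>(i, j). M i j) $$ (\<pi> j, j)))"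
    by (rule det_col) simp
  also have "\<dots> = column_det m t M (\<lambda>i. M i t)"
    unfolding column_det_def
  proof (rule sum.cong[OF refl])
    fix \<pi> assume "\<pi> \<in> {\<pi>. \<pi> permutes {0..<m}}"
    then have "\<pi> j < m" if "j < m" for j
      using that permutes_in_image[of \<pi> "{0..<m}" j] by auto
    then have "(\<Prod>j<m. Matrix.mat m m (\<lambda>(i, j). M i j) $$ (\<pi> j, j)) = (\<Prod>j\<in>{0..<m}. M (\<pi> j) j)"
      by (intro prod.cong) auto
    also have "\<dots> = M (\<pi> t) t * (\<Prod>j\<in>{0..<m} - {t}. M (\<pi> j) j)"
      using assms by (intro prod.remove) auto
    finally show "of_int (sign \<pi>) * (\<Prod>j<m. Matrix.mat m m (\<lambda>(i, j). M i j) $$ (\<pi> j, j)) =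
        of_int (sign \<pi>) * (M (\<pi> t) t * (\<Prod>j\<in>{0..<m} - {t}. M (\<pi> j) j))"
      by simp
  qed
  finally show ?thesis .
qed

lemma column_det_diff:
  "column_det m t M (\<lambda>i. c i - d i) = column_det m t M c - column_det m t M d"
  by (simp add: column_det_def algebra_simps sum_subtractf)

lemma column_det_cong:
  assumes "\<And>i j. j < m \<Longrightarrow> j \<noteq> t \<Longrightarrow> M i j = N i j"
  shows "column_det m t M c = column_det m t N c"
  unfolding column_det_def using assms by (intro sum.cong refl arg_cong2[of _ _ _ _ "(*)"] prod.cong) auto

text \<open>If the columns of \<open>M\<close> other than \<open>t\<close> are closed, the cofactors along column \<open>t\<close> are
  divergence free, so that the determinant with a gradient in column \<open>t\<close> is a divergence.\<close>

lemma column_det_theta: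
  fixes M :: "nat \<Rightarrow> nat \<Rightarrow> 'n::{finite,linorder} ratfun"
  assumes t: "t < m"
    and closed: "\<And>i i' j. j < m \<Longrightarrow> j \<noteq> t \<Longrightarrow> theta (x i) (M i' j) = theta (x i') (M i j)"
  shows "column_det m t M (\<lambda>i. theta (x i) u) = (\<Sum>\<pi> | \<pi> permutes {0..<m}.
     theta (x (\<pi> t)) (of_int (sign \<pi>) * (u * (\<Prod>j\<in>{0..<m} - {t}. M (\<pi> j) j))))"
proof -
  let ?J = "{0..<m} - {t}"
  let ?S = "{\<pi>. \<pi> permutes {0..<m}}"
  \<comment> \<open>The term of the product rule in which the derivative falls on the factor from
    column \<open>j\<close>.\<close>
  define X where "X j \<pi> = theta (x (\<pi> t)) (M (\<pi> j) j) * (\<Prod>l\<in>?J - {j}. M (\<pi> l) l)" for j \<pi>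
  define Y where "Y j = (\<Sum>\<pi>\<in>?S. of_int (sign \<pi>) * X j \<pi>)" for j
  have "Y j = 0" if j: "j \<in> ?J" for j
  proof -
    \<comment> \<open>Exchanging the rows assigned to columns \<open>t\<close> and \<open>j\<close>
      flips the sign of the permutation and, as column \<open>j\<close> is closed, preserves
      \<open>X j\<close>; so the terms of \<open>Y j\<close> cancel in pairs.\<close>
    let ?\<tau> = "Transposition.transpose t j"
    have \<tau>: "?\<tau> permutes {0..<m}"
      using t j by (intro permutes_swap_id) auto
    have X: "X j (\<pi> \<circ> ?\<tau>) = X j \<pi>" for \<pi>
    proof -
      have "(\<Prod>l\<in>?J - {j}. M ((\<pi> \<circ> ?\<tau>) l) l) = (\<Prod>l\<in>?J - {j}. M (\<pi> l) l)"
        by (intro prod.cong) (auto simp: Transposition.transpose_def)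
      then show ?thesis
        using closed[of j "\<pi> j" "\<pi> t"] j by (simp add: X_def)
    qed
    have sgn: "sign (\<pi> \<circ> ?\<tau>) = - sign \<pi>" if "\<pi> \<in> ?S" for \<pi>
    proof -
      have "permutation \<pi>" "permutation ?\<tau>"
        using that \<tau> by (auto intro: permutation_permutes[THEN iffD2] exI[of _ "{0..<m}"])
      then have "sign (\<pi> \<circ> ?\<tau>) = sign \<pi> * sign ?\<tau>"
        by (rule sign_compose)
      then show ?thesis
        using j by (auto simp: sign_swap_id)
    qed
    have "Y j = (\<Sum>\<pi>\<in>?S. of_int (sign (\<pi> \<circ> ?\<tau>)) * X j (\<pi> \<circ> ?\<tau>))"
      unfolding Y_def by (rule sum_permutations_compose_right[OF \<tau>])
    also have "\<dots> = - Y j"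
      unfolding Y_def sum_negf[symmetric] by (intro sum.cong refl) (simp add: X sgn)
    finally have "Y j + Y j = 0"
      by (rule eq_neg_iff_add_eq_0[THEN iffD1])
    then have "2 * Y j = 0"
      by (simp only: mult_2)
    then show ?thesis
      by (simp only: mult_eq_0_iff) simp
  qed
  then have "u * (\<Sum>j\<in>?J. Y j) = 0"
    by simp
  moreover have "u * (\<Sum>j\<in>?J. Y j) = (\<Sum>\<pi>\<in>?S. of_int (sign \<pi>) * (u * (\<Sum>j\<in>?J. X j \<pi>)))"
    unfolding Y_def by (subst sum.swap) (simp add: sum_distrib_left mult.left_commute)
  moreover have "(\<Sum>j\<in>?J. X j \<pi>) = theta (x (\<pi> t)) (\<Prod>j\<in>?J. M (\<pi> j) j)" for \<pi>
    by (simp add: theta_prod X_def)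
  ultimately have "(\<Sum>\<pi>\<in>?S. of_int (sign \<pi>) * (u * theta (x (\<pi> t)) (\<Prod>j\<in>?J. M (\<pi> j) j))) = 0"
    by simp
  then show ?thesis
    by (simp add: column_det_def theta_mult distrib_left sum.distrib)
qed

lemma coeffs_divisible_column_det:
  fixes M :: "nat \<Rightarrow> nat \<Rightarrow> 'n::{finite,linorder} ratfun"
  assumes p: "prime p" and t: "t < m"
    and closed: "\<And>i i' j. j < m \<Longrightarrow> j \<noteq> t \<Longrightarrow> theta (x i) (M i' j) = theta (x i') (M i j)"
    and M: "\<And>i j. j < m \<Longrightarrow> p_integral_ratfun w p (M i j)"
    and u: "p_integral_ratfun w p u"
    and e: "\<And>i. p_integral_ratfun w p (e i)"
  shows "coeffs_divisible w p r (column_det m t M (\<lambda>i. theta (x i) u + of_nat p ^ r * e i))"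
proof -
  have prod: "p_integral_ratfun w p (\<Prod>j\<in>{0..<m} - {t}. M (\<pi> j) j)" for \<pi>
    using M by (intro p_integral_ratfun_prod[OF p]) auto
  have "column_det m t M (\<lambda>i. theta (x i) u + of_nat p ^ r * e i) =
      column_det m t M (\<lambda>i. theta (x i) u) + of_nat p ^ r * column_det m t M e"
    by (simp add: column_det_def algebra_simps sum.distrib sum_distrib_left)
  moreover have "column_det m t M (\<lambda>i. theta (x i) u) = (\<Sum>\<pi> | \<pi> permutes {0..<m}.
      theta (x (\<pi> t)) (of_int (sign \<pi>) * (u * (\<Prod>j\<in>{0..<m} - {t}. M (\<pi> j) j))))"
    using t closed by (rule column_det_theta)
  then have "coeffs_divisible w p r (column_det m t M (\<lambda>i. theta (x i) u))"
    by (simp only:) (intro coeffs_divisible_sum[OF p] coeffs_divisible_theta[OF p] p_integral_ratfun_mult[OF p]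
        p_integral_ratfun_of_int[OF p] u prod)
  moreover have "coeffs_divisible w p r (of_nat p ^ r * column_det m t M e)"
    unfolding column_det_def
    by (intro coeffs_divisible_mult[OF p] p_integral_ratfun_sum[OF p] p_integral_ratfun_mult[OF p]
        p_integral_ratfun_of_int[OF p] e prod)
  ultimately show ?thesis
    using coeffs_divisible_add[OF p] by simp
qed

section \<open>The determinant under the Frobenius lift\<close>

lemma ratfun_frob_det:
  fixes M :: "nat \<Rightarrow> nat \<Rightarrow> 'n::{finite,linorder} ratfun"
  assumes "p > 0"
  shows "ratfun_frob p (Determinant.det (Matrix.mat m m (\<lambda>(i, j). M i j))) =
    Determinant.det (Matrix.mat m m (\<lambda>(i, j). ratfun_frob p (M i j)))"
proof -
  have of_int: "ratfun_frob p (of_int n) = (of_int n :: 'n ratfun)" for n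
  proof -
    have of_nat: "ratfun_frob p (of_nat k) = (of_nat k :: 'n ratfun)" for k
      using assms by (induction k) (auto simp: ratfun_frob_add)
    show ?thesis
      using assms by (cases n) (auto simp: of_nat ratfun_frob_uminus simp del: of_nat_Suc)
  qed
  show ?thesis
    unfolding det_col[OF Matrix.mat_carrier] ratfun_frob_sum[OF assms] ratfun_frob_mult[OF assms]
      ratfun_frob_prod[OF assms] of_int
  proof (intro sum.cong refl arg_cong2[of _ _ _ _ "(*)"] prod.cong)
    fix \<pi> j assume "\<pi> \<in> {\<pi>. \<pi> permutes {0..<m}}" "j \<in> {..<m}"
    then have "\<pi> j < m" "j < m"
      using permutes_in_image[of \<pi> "{0..<m}" j] by auto
    then show "ratfun_frob p (Matrix.mat m m (\<lambda>(i, j). M i j) $$ (\<pi> j, j)) =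
        Matrix.mat m m (\<lambda>(i, j). ratfun_frob p (M i j)) $$ (\<pi> j, j)"
      by simp
  qed
qed

text \<open>The Frobenius lift changes the columns one at a time, and each change is a gradient
  modulo \<open>p ^ r\<close>.\<close>

lemma coeffs_divisible_frob_det:
  fixes A :: "nat \<Rightarrow> nat \<Rightarrow> 'n::{finite,linorder} ratfun"
  assumes p: "prime p"
    and closed: "\<And>i i' j. j < m \<Longrightarrow> theta (x i) (A i' j) = theta (x i') (A i j)"
    and A: "\<And>i j. j < m \<Longrightarrow> p_integral_ratfun w p (A i j)"
    and frob: "\<And>j. j < m \<Longrightarrow> \<exists>u. p_integral_ratfun w p u \<and> (\<forall>i. \<exists>e. p_integral_ratfun w p e \<and>
      ratfun_frob p (A i j) = A i j + theta (x i) u + of_nat p ^ r * e)"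
  defines "d \<equiv> Determinant.det (Matrix.mat m m (\<lambda>(i, j). A i j))"
  shows "coeffs_divisible w p r (ratfun_frob p d - d)"
proof -
  have p0: "p > 0" using p by (rule prime_gt_0_nat)
  \<comment> \<open>A hybrid matrix whose columns below \<open>t\<close> are already replaced by
    their Frobenius images; raising \<open>t\<close> by one changes column \<open>t\<close>
    only.\<close>
  define H where "H t i j = (if j < t then ratfun_frob p (A i j) else A i j)" for t i j
  define D where "D t = Determinant.det (Matrix.mat m m (\<lambda>(i, j). H t i j))" for t
  have "coeffs_divisible w p r (D (Suc t) - D t)" if t: "t < m" for t
  proof -
    obtain u where u: "p_integral_ratfun w p u" "\<And>i. \<exists>e. p_integral_ratfun w p e \<and>
        ratfun_frob p (A i t) = A i t + theta (x i) u + of_nat p ^ r * e"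
      using frob[OF t] by blast
    then obtain e where e: "\<And>i. p_integral_ratfun w p (e i)"
      "\<And>i. ratfun_frob p (A i t) = A i t + theta (x i) u + of_nat p ^ r * e i"
      by metis
    have "D (Suc t) = column_det m t (H t) (\<lambda>i. ratfun_frob p (A i t))"
    proof -
      have "D (Suc t) = column_det m t (H (Suc t)) (\<lambda>i. H (Suc t) i t)"
        unfolding D_def by (rule det_eq_column_det[OF t])
      also have "\<dots> = column_det m t (H t) (\<lambda>i. H (Suc t) i t)"
        by (rule column_det_cong) (auto simp: H_def)
      finally show ?thesis by (simp add: H_def)
    qed
    moreover have "D t = column_det m t (H t) (\<lambda>i. A i t)"
    proof -
      have "(\<lambda>i. H t i t) = (\<lambda>i. A i t)"
        by (simp add: H_def)
      then show ?thesis
        unfolding D_def det_eq_column_det[OF t] by (simp only:)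
    qed
    ultimately have "D (Suc t) - D t = column_det m t (H t) (\<lambda>i. theta (x i) u + of_nat p ^ r * e i)"
      by (simp add: e(2) flip: column_det_diff)
    moreover have "coeffs_divisible w p r (column_det m t (H t) (\<lambda>i. theta (x i) u + of_nat p ^ r * e i))"
    proof (rule coeffs_divisible_column_det[OF p t _ _ u(1) e(1)])
      \<comment> \<open>Replaced columns stay closed because the lift commutes with the derivations
        up to the common factor \<open>p\<close>.\<close>
      show "theta (x i) (H t i' j) = theta (x i') (H t i j)" if "j < m" for i i' j
        using closed[OF that, of i i'] by (simp add: H_def theta_frob[OF p0])
      show "p_integral_ratfun w p (H t i j)" if "j < m" for i j
        using A[OF that] by (simp add: H_def p_integral_ratfun_frob[OF p])
    qed
    ultimately show ?thesis by simp
  qed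
  then have "coeffs_divisible w p r (\<Sum>t<m. D (Suc t) - D t)"
    by (intro coeffs_divisible_sum[OF p]) auto
  also have "(\<Sum>t<m. D (Suc t) - D t) = D m - D 0"
    by (rule sum_lessThan_telescope)
  also have "D m = ratfun_frob p d"
    unfolding d_def ratfun_frob_det[OF p0] D_def
    by (intro arg_cong[of _ _ Determinant.det] eq_matI) (auto simp: H_def)
  also have "D 0 = d"
    by (simp add: D_def d_def H_def)
  finally show ?thesis .
qed

lemma p_integral_ratfun_det:
  fixes A :: "nat \<Rightarrow> nat \<Rightarrow> 'n::{finite,linorder} ratfun"
  assumes p: "prime p" and A: "\<And>i j. j < m \<Longrightarrow> p_integral_ratfun w p (A i j)"
  shows "p_integral_ratfun w p (Determinant.det (Matrix.mat m m (\<lambda>(i, j). A i j)))"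
  unfolding det_col[OF Matrix.mat_carrier]
proof (intro p_integral_ratfun_sum[OF p] p_integral_ratfun_mult[OF p] p_integral_ratfun_of_int[OF p]
    p_integral_ratfun_prod[OF p])
  fix \<pi> j assume "\<pi> \<in> {\<pi>. \<pi> permutes {0..<m}}" "j \<in> {..<m}"
  then have "\<pi> j < m" "j < m"
    using permutes_in_image[of \<pi> "{0..<m}" j] by auto
  then show "p_integral_ratfun w p (Matrix.mat m m (\<lambda>(i, j). A i j) $$ (\<pi> j, j))"
    using A by simp
qed

text \<open>Every Leibniz term takes one entry from each row and one from each column, so all terms
  carry the same scalar.\<close>

lemma det_scale_rows_columns:
  fixes a b :: "nat \<Rightarrow> 'a::field"
  shows "Determinant.det (Matrix.mat m m (\<lambda>(i, j). a i * M i j / b j)) =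
    (\<Prod>i<m. a i) / (\<Prod>j<m. b j) * Determinant.det (Matrix.mat m m (\<lambda>(i, j). M i j))"
  unfolding det_col[OF Matrix.mat_carrier] sum_distrib_left
proof (rule sum.cong[OF refl])
  fix \<pi> assume \<pi>: "\<pi> \<in> {\<pi>. \<pi> permutes {0..<m}}"
  have "\<pi> j < m" if "j < m" for j
    using \<pi> that permutes_in_image[of \<pi> "{0..<m}" j] by auto
  then have "(\<Prod>j<m. Matrix.mat m m (\<lambda>(i, j). a i * M i j / b j) $$ (\<pi> j, j)) =
      (\<Prod>j<m. a (\<pi> j)) / (\<Prod>j<m. b j) * (\<Prod>j<m. Matrix.mat m m (\<lambda>(i, j). M i j) $$ (\<pi> j, j))"
    by (simp add: prod.distrib prod_dividef)
  also have "(\<Prod>j<m. a (\<pi> j)) = (\<Prod>i<m. a i)"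
    using prod.permute[of \<pi> "{..<m}" a] \<pi> by (simp add: lessThan_atLeast0 o_def)
  finally show "of_int (sign \<pi>) * (\<Prod>j<m. Matrix.mat m m (\<lambda>(i, j). a i * M i j / b j) $$ (\<pi> j, j)) =
      (\<Prod>i<m. a i) / (\<Prod>j<m. b j) * (of_int (sign \<pi>) * (\<Prod>j<m. Matrix.mat m m (\<lambda>(i, j). M i j) $$ (\<pi> j, j)))"
    by simp
qed

section \<open>Gauss congruences and exceptional primes\<close>

lemma gauss_congruences_expansion:
  assumes p: "prime p" and F: "p_integral_ratfun w p F" "expands w F g"
    and frob: "\<And>r. coeffs_divisible w p r (ratfun_frob p F - F)"
  shows "gauss_congruences p g"
  unfolding gauss_congruences_def
proof (intro conjI allI impI)
  have p0: "p > 0" using p by (rule prime_gt_0_nat)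
  show "p_integral p (g k)" for k
    using p_integral_ratfun_expands[OF p F(1)] expands_unique[OF F(2)] by metis
  fix k r assume r: "1 \<le> (r::nat)"
  obtain h where h: "expands w (ratfun_frob p F - F) h" "p_cong p r (h (frag_cmul (int (p ^ r)) k)) 0"
    using frob[of r] unfolding coeffs_divisible_def by blast
  have "h = (\<lambda>k. series_frob p g k - g k)"
    using expands_unique[OF h(1) expands_diff[OF expands_frob[OF p0 F(2)] F(2)]] .
  \<comment> \<open>As \<open>r \<ge> 1\<close>, one factor \<open>p\<close> splits off, so the
    lifted series at \<open>p ^ r\<close> times \<open>k\<close> has the coefficient of
    \<open>g\<close> at \<open>p ^ (r - 1)\<close> times \<open>k\<close>.\<close>
  moreover have "frag_cmul (int (p ^ r)) k = frag_cmul (int p) (frag_cmul (int (p ^ (r - 1))) k)"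
    using r by (cases r) auto
  then have "series_frob p g (frag_cmul (int (p ^ r)) k) = g (frag_cmul (int (p ^ (r - 1))) k)"
    by (simp only: series_frob_frag_cmul[OF p0])
  ultimately obtain c where c: "p_integral p c"
    "g (frag_cmul (int (p ^ (r - 1))) k) - g (frag_cmul (int (p ^ r)) k) = of_nat (p ^ r) * c"
    using h(2) unfolding p_cong_def by auto
  then show "p_cong p r (g (frag_cmul (int (p ^ r)) k)) (g (frag_cmul (int (p ^ (r - 1))) k))"
    unfolding p_cong_def using p_integral_uminus[OF p]
    by (intro exI[of _ "- c"]) (simp add: algebra_simps)
qed

text \<open>Only primes dividing \<open>B\<close>, the product of all leading coefficients of the
  chosen fractions of the \<open>f j\<close>, can fail. They depend on the vertex through the
  weight, but not on \<open>r\<close>.\<close>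

lemma gauss_property_det_dlog:
  fixes f :: "nat \<Rightarrow> 'n::{finite,linorder} ratfun"
  assumes f: "\<And>j. j < m \<Longrightarrow> f j \<noteq> 0"
  shows "gauss_property (Determinant.det (Matrix.mat m m (\<lambda>(i, j). theta (x i) (f j) / f j)))"
  unfolding gauss_property_def
proof (intro allI impI, elim conjE)
  let ?d = "Determinant.det (Matrix.mat m m (\<lambda>(i, j). theta (x i) (f j) / f j))"
  fix P Q :: "('n, int) laurent" and v
  assume Q: "Q \<noteq> 0" and d: "?d = Fract P Q" and v: "newton_vertex Q v"
  obtain w where w: "\<And>k. weight w k = 0 \<Longrightarrow> k = 0" "lead_exponent w Q v"
    using newton_vertex_generic_weight[OF v] by metis
  \<comment> \<open>The weight was chosen for \<open>Q\<close>, but since it separates all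
    exponents, these Laurent polynomials have leading exponents too.\<close>
  have "\<exists>R S u u'. f j = Fract R S \<and> lead_exponent w R u \<and> lead_exponent w S u'" if j: "j < m" for j
  proof -
    obtain R S where RS: "f j = Fract R S" "S \<noteq> 0" "R \<noteq> 0"
      using f[OF j] by (cases "f j" rule: Fract_cases_nonzero) auto
    then show ?thesis
      using lead_exponent_exists[OF w(1)] by metis
  qed
  then obtain R S u u' where RS: "\<And>j. j < m \<Longrightarrow> f j = Fract (R j) (S j)"
    and R: "\<And>j. j < m \<Longrightarrow> lead_exponent w (R j) (u j)"
    and S: "\<And>j. j < m \<Longrightarrow> lead_exponent w (S j) (u' j)"
    by metis
  define B where "B = (\<Prod>j<m. Poly_Mapping.lookup (R j) (u j) * Poly_Mapping.lookup (S j) (u' j))"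
  have "B \<noteq> 0"
    using R S by (auto simp: B_def lead_exponent_def in_keys_iff)
  have "gauss_congruences p (laurent_expansion P Q v)" if p: "prime p" and B: "\<not> int p dvd B" for p
  proof -
    have lc: "\<not> int p dvd Poly_Mapping.lookup (R j) (u j)" "\<not> int p dvd Poly_Mapping.lookup (S j) (u' j)"
      if "j < m" for j
    proof -
      have "Poly_Mapping.lookup (R j) (u j) * Poly_Mapping.lookup (S j) (u' j) dvd B"
        unfolding B_def using that by (intro dvd_prodI) auto
      then show "\<not> int p dvd Poly_Mapping.lookup (R j) (u j)" "\<not> int p dvd Poly_Mapping.lookup (S j) (u' j)"
        using B dvd_trans[OF dvd_mult2] dvd_trans[OF dvd_mult] by metis+
    qed
    have int: "p_integral_ratfun w p (theta (x i) (f j) / f j)" if "j < m" for i j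
      using p_integral_dlog[OF p R lc(1) S lc(2) RS] that by blast
    show ?thesis
    proof (rule gauss_congruences_expansion[OF p])
      show "p_integral_ratfun w p ?d"
        using int by (intro p_integral_ratfun_det[OF p])
      show "expands w ?d (laurent_expansion P Q v)"
        unfolding d by (rule expands_laurent_expansion[OF w(2)])
      show "coeffs_divisible w p r (ratfun_frob p ?d - ?d)" for r
      proof (rule coeffs_divisible_frob_det[OF p _ int])
        show "theta (x i) (theta (x i') (f j) / f j) = theta (x i') (theta (x i) (f j) / f j)"
          if "j < m" for i i' j
          using f[OF that] by (rule theta_dlog_symmetric)
        fix j assume j: "j < m"
        \<comment> \<open>Truncating the logarithm at order \<open>r\<close> gives the error its
          factor \<open>p ^ r\<close>; a different \<open>g\<close> for each \<open>r\<close> is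
          harmless.\<close>
        obtain g where "p_integral_ratfun w p g" "\<And>i. \<exists>e. p_integral_ratfun w p e \<and>
            ratfun_frob p (theta i (f j) / f j) = theta i (f j) / f j + theta i g + of_nat p ^ r * e"
          using dlog_frob[OF p R[OF j] lc(1)[OF j] S[OF j] lc(2)[OF j] RS[OF j]] by metis
        then show "\<exists>g. p_integral_ratfun w p g \<and> (\<forall>i. \<exists>e. p_integral_ratfun w p e \<and>
            ratfun_frob p (theta (x i) (f j) / f j) =
            theta (x i) (f j) / f j + theta (x i) g + of_nat p ^ r * e)"
          by blast
      qed
    qed
  qed
  then have "{p. prime p \<and> \<not> gauss_congruences p (laurent_expansion P Q v)} \<subseteq> {p. p dvd nat \<bar>B\<bar>}"
    by (auto simp flip: int_dvd_int_iff)
  then show "series_gauss_property (laurent_expansion P Q v)"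
    unfolding series_gauss_property_def
    by (rule finite_subset) (use \<open>B \<noteq> 0\<close> finite_divisors_nat[of "nat \<bar>B\<bar>"] in simp)
qed

theorem theorem4p5:
  fixes f :: "nat \<Rightarrow> 'n::{finite,linorder} ratfun" and m :: nat
  assumes "m \<le> CARD('n)"
    and "\<And>j. j < m \<Longrightarrow> f j \<noteq> 0"
  shows "Determinant.det (Matrix.mat m m (\<lambda>(i, j). theta (var i) (f j) / f j)) =
           (\<Prod>i<m. ratfun_var (var i)) / (\<Prod>j<m. f j) *
           Determinant.det (Matrix.mat m m (\<lambda>(i, j). ratfun_pderiv (var i) (f j)))
       \<and> gauss_property
           (Determinant.det (Matrix.mat m m (\<lambda>(i, j). theta (var i) (f j) / f j)))"
proof
  show "gauss_property (Determinant.det (Matrix.mat m m (\<lambda>(i, j). theta (var i) (f j) / f j)))"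
    using assms(2) by (rule gauss_property_det_dlog)
  show "Determinant.det (Matrix.mat m m (\<lambda>(i, j). theta (var i) (f j) / f j)) =
      (\<Prod>i<m. ratfun_var (var i)) / (\<Prod>j<m. f j) *
      Determinant.det (Matrix.mat m m (\<lambda>(i, j). ratfun_pderiv (var i) (f j)))"
    unfolding theta_def by (rule det_scale_rows_columns)
qed

end
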